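(* Let $d\ge2$, let $2\le n_1<\dots<n_d$ be integers, and let $F\subset[0,1]^d$ be the Bedford--McMullen sponge generated by a set $\mathcal{D}\subset\prod_{q=1}^d\{0,\dots,n_q-1\}$ with at least two elements; assume that $F$ has non-uniform fibres. Let $N_{k,\max},N_{k,\min}$ ($1\le k\le d-1$) be as defined in the context. (1) If $\theta\in\left(0,\frac{\log n_1}{\log n_d}\right]$, then $$\dim_{\mathrm A}^{\theta}F=\frac{\dim_{\mathrm B}F-\theta\left(\frac{\log(|\mathcal{D}|/N_{1,\max})}{\log n_1}+\sum_{k=1}^{d-2}\frac{\log(N_{k,\max}/N_{k+1,\max})}{\log n_{k+1}}+\frac{\log N_{d-1,\max}}{\log n_d}\right)}{1-\theta}$$ and $$\dim_{\mathrm L}^{\theta}F=\frac{\dim_{\mathrm B}F-\theta\left(\frac{\log(|\mathcal{D}|/N_{1,\min})}{\log n_1}+\sum_{k=1}^{d-2}\frac{\log(N_{k,\min}/N_{k+1,\min})}{\log n_{k+1}}+\frac{\log N_{d-1,\min}}{\log n_d}\right)}{1-\theta}.$$ (2) If $\theta\in\left[\max_{1\le p<q\le d}\frac{\log n_p}{\log n_q},1\right)$, then $\dim_{\mathrm A}^{\theta}F=\dim_{\mathrm A}F$ and $\dim_{\mathrm L}^{\theta}F=\dim_{\mathrm L}F$.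
   Context: **Dimensions.** For bounded $E\subset\mathbb{R}^d$ and $r>0$, $N(E,r)$ is the minimal number of balls of radius $r$ required to cover $E$; $B(x,R)$ is the closed ball with centre $x$ and radius $R$. Let $F\subset\mathbb{R}^d$ be non-empty and compact. - Box dimension: $\dim_{\mathrm B}F=\lim_{r\to0}\frac{\log N(F,r)}{\log(1/r)}$ when the limit exists (it does for Bedford--McMullen sponges). - Assouad dimension: $\dim_{\mathrm A}F$ is the infimum of all $s>0$ for which there is $C>0$ such that $N(B(x,R)\cap F,r)\le C(R/r)^s$ for all $x\in F$ and $0<r<R$. - Lower dimension: $\dim_{\mathrm L}F$ is the supremum of all $s>0$ for which there is $C>0$ such that $N(B(x,R)\cap F,r)\ge C(R/r)^s$ for all $x\in F$ and $0<r<R<1$. - For $\theta\in(0,1)$, the Assouad spectrum $\dim_{\mathrm A}^{\theta}F$ is the infimum of all $s>0$ for which there is $C>0$ such that $N(B(x,R)\cap F,R^{1/\theta})\le C(R/R^{1/\theta})^s$ for all $0<R<1$ and $x\in F$. - For $\theta\in(0,1)$, the lower spectrum $\dim_{\mathrm L}^{\theta}F$ is the supremum of all $s>0$ for which there is $C>0$ such that $N(B(x,R)\cap F,R^{1/\theta})\ge C(R/R^{1/\theta})^s$ for all $0<R<1$ and $x\in F$. The supremum of the empty set is taken to be $0$. **Bedford--McMullen sponges.** Let $2\le n_1<\dots<n_d$ be integers, $\mathcal{I}_q=\{0,\dots,n_q-1\}$, and let $\mathcal{D}\subset\prod_{q=1}^d\mathcal{I}_q$ have at least two elements. For $\bar\imath=(i_1,\dots,i_d)\in\mathcal{D}$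 let $\varphi_{\bar\imath}(x_1,\dots,x_d)=\left(\frac{x_1+i_1}{n_1},\dots,\frac{x_d+i_d}{n_d}\right)$ on $[0,1]^d$. Let $\mathcal{D}^\infty$ be the set of infinite words $\omega=(\bar\imath_1,\bar\imath_2,\dots)$ over $\mathcal{D}$ and $\Pi(\omega)$ the unique point of $\bigcap_{l\in\mathbb{N}}\varphi_{\bar\imath_1}\circ\cdots\circ\varphi_{\bar\imath_l}([0,1]^d)$. The Bedford--McMullen sponge generated by $\mathcal{D}$ is $F=\Pi(\mathcal{D}^\infty)$. For $1\le l\le d$, $\pi_l$ denotes projection of $\mathcal{D}$ onto the first $l$ coordinates, and for $1\le l\le d-1$ and $(i_1,\dots,i_l)\in\pi_l\mathcal{D}$, $$N(i_1,\dots,i_l)=|\{i_{l+1}\in\mathcal{I}_{l+1}:(i_1,\dots,i_l,i_{l+1})\in\pi_{l+1}\mathcal{D}\}|.$$ $F$ has uniform fibres if for every $l=1,\dots,d-1$ the number $N(i_1,\dots,i_l)$ is the same for all $(i_1,\dots,i_l)\in\pi_l\mathcal{D}$; otherwise it has non-uniform fibres. **Notation.** $N_{d-1,\max}$ and $N_{d-1,\min}$ are the maximum and minimum of $N(i_1,\dots,i_{d-1})$ over $(i_1,\dots,i_{d-1})\in\pi_{d-1}\mathcal{D}$. For $1\le k\le d-2$, $N_{k,\max}$ and $N_{k,\min}$ are the maximum and minimum, over $(i_1,\dots,i_k)\in\pi_k\mathcal{D}$, of $$\sum_{i_{k+1}:(i_1,\dots,i_{k+1})\in\pi_{k+1}\mathcal{D}}\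 \sum_{i_{k+2}:(i_1,\dots,i_{k+2})\in\pi_{k+2}\mathcal{D}}\cdots\sum_{i_{d-1}:(i_1,\dots,i_{d-1})\in\pi_{d-1}\mathcal{D}}N(i_1,\dots,i_{d-1}).$$ Empty sums are $0$. *)

theory Defs
  imports "HOL-Analysis.Analysis"
begin

section \<open>Dimensions of subsets of Euclidean space\<close>

text \<open>
  Covering balls are closed and their centres may be any points of the ambient space.
  The definitions are meant for non-empty compact sets, where all infima and suprema below
  are taken over bounded sets.
\<close>

definition covering_number :: "'a::euclidean_space set \<Rightarrow> real \<Rightarrow> nat" where
  "covering_number E r =
     (LEAST k. \<exists>C. finite C \<and> card C = k \<and> E \<subseteq> (\<Union>x\<in>C. cball x r))"

definition box_dim :: "'a::euclidean_space set \<Rightarrow> real" where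
  "box_dim F = Lim (at_right 0) (\<lambda>r. ln (real (covering_number F r)) / ln (1 / r))"

text \<open>
  \<open>Sup {}\<close> is unspecified for reals; the convention here is that it equals 0.
\<close>

definition Sup0 :: "real set \<Rightarrow> real" where
  "Sup0 S = (if S = {} then 0 else Sup S)"

definition assouad_dim :: "'a::euclidean_space set \<Rightarrow> real" where
  "assouad_dim F = Inf {s. s > 0 \<and> (\<exists>C>0. \<forall>x\<in>F. \<forall>r R. 0 < r \<and> r < R \<longrightarrow>
     real (covering_number (cball x R \<inter> F) r) \<le> C * (R / r) powr s)}"

definition lower_dim :: "'a::euclidean_space set \<Rightarrow> real" where
  "lower_dim F = Sup0 {s. s > 0 \<and> (\<exists>C>0. \<forall>x\<in>F. \<forall>r R. 0 < r \<and> r < R \<and> R < 1 \<longrightarrow>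
     real (covering_number (cball x R \<inter> F) r) \<ge> C * (R / r) powr s)}"

definition assouad_spectrum :: "real \<Rightarrow> 'a::euclidean_space set \<Rightarrow> real" where
  "assouad_spectrum \<theta> F = Inf {s. s > 0 \<and> (\<exists>C>0. \<forall>R. 0 < R \<and> R < 1 \<longrightarrow> (\<forall>x\<in>F.
     real (covering_number (cball x R \<inter> F) (R powr (1 / \<theta>)))
       \<le> C * (R / R powr (1 / \<theta>)) powr s))}"

definition lower_spectrum :: "real \<Rightarrow> 'a::euclidean_space set \<Rightarrow> real" where
  "lower_spectrum \<theta> F = Sup0 {s. s > 0 \<and> (\<exists>C>0. \<forall>R. 0 < R \<and> R < 1 \<longrightarrow> (\<forall>x\<in>F.
     real (covering_number (cball x R \<inter> F) (R powr (1 / \<theta>)))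
       \<ge> C * (R / R powr (1 / \<theta>)) powr s))}"


section \<open>Bedford--McMullen sponges\<close>

text \<open>
  The integers $n_1, \dots, n_d$ are a function \<open>n :: nat \<Rightarrow> nat\<close> of which only the values on
  \<open>{1..d}\<close> matter. A digit tuple $(i_1, \dots, i_l)$ is a function \<open>nat \<Rightarrow> nat\<close> that is
  extensional on \<open>{1..l}\<close>, that is, \<open>undefined\<close> outside \<open>{1..l}\<close>.
\<close>

definition digit_tuples :: "nat \<Rightarrow> (nat \<Rightarrow> nat) \<Rightarrow> (nat \<Rightarrow> nat) set" where
  "digit_tuples d n = (\<Pi>\<^sub>E q\<in>{1..d}. {0..<n q})"

text \<open>
  Position, from 1 to \<open>CARD('d)\<close>, of a coordinate of \<open>real ^ 'd\<close> in the linear order of \<open>'d\<close>.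
\<close>

definition coord_pos :: "'d::{finite,linorder} \<Rightarrow> nat" where
  "coord_pos c = card {..c}"

definition sponge_map ::
    "(nat \<Rightarrow> nat) \<Rightarrow> (nat \<Rightarrow> nat) \<Rightarrow>
      real ^ ('d::{finite,linorder}) \<Rightarrow> real ^ ('d::{finite,linorder})" where
  "sponge_map n i x = (\<chi> c. (x $ c + real (i (coord_pos c))) / real (n (coord_pos c)))"

text \<open>
  Infinite words are indexed from 0, so \<open>sponge_comp n \<omega> l\<close> is the composition of the maps of
  the \<open>l\<close> letters \<open>\<omega> 0, \<dots>, \<omega> (l - 1)\<close>, with the map of \<open>\<omega> 0\<close> outermost.
\<close>

primrec sponge_comp ::
    "(nat \<Rightarrow> nat) \<Rightarrow> (nat \<Rightarrow> nat \<Rightarrow> nat) \<Rightarrow> nat \<Rightarrow>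
      real ^ ('d::{finite,linorder}) \<Rightarrow> real ^ ('d::{finite,linorder})" where
  "sponge_comp n \<omega> 0 = id"
| "sponge_comp n \<omega> (Suc l) = sponge_comp n \<omega> l \<circ> sponge_map n (\<omega> l)"

definition sponge_point ::
    "(nat \<Rightarrow> nat) \<Rightarrow> (nat \<Rightarrow> nat \<Rightarrow> nat) \<Rightarrow> real ^ ('d::{finite,linorder})" where
  "sponge_point n \<omega> = (THE x. x \<in> (\<Inter>l. sponge_comp n \<omega> l ` cbox 0 1))"

definition sponge ::
    "(nat \<Rightarrow> nat) \<Rightarrow> (nat \<Rightarrow> nat) set \<Rightarrow> (real ^ ('d::{finite,linorder})) set" where
  "sponge n D = sponge_point n ` (UNIV \<rightarrow> D)"

definition digit_proj :: "nat \<Rightarrow> (nat \<Rightarrow> nat) set \<Rightarrow> (nat \<Rightarrow> nat) set" where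
  "digit_proj l D = (\<lambda>i. restrict i {1..l}) ` D"

definition fibre :: "(nat \<Rightarrow> nat) \<Rightarrow> (nat \<Rightarrow> nat) set \<Rightarrow> nat \<Rightarrow> (nat \<Rightarrow> nat) \<Rightarrow> nat set" where
  "fibre n D l i = {j \<in> {0..<n (Suc l)}. i(Suc l := j) \<in> digit_proj (Suc l) D}"

definition uniform_fibres :: "nat \<Rightarrow> (nat \<Rightarrow> nat) \<Rightarrow> (nat \<Rightarrow> nat) set \<Rightarrow> bool" where
  "uniform_fibres d n D \<longleftrightarrow>
     (\<forall>l\<in>{1..d - 1}. \<forall>i\<in>digit_proj l D. \<forall>j\<in>digit_proj l D.
       card (fibre n D l i) = card (fibre n D l j))"

text \<open>
  \<open>fibre_sum n D m l i\<close> is the \<open>m\<close>-fold nested sum over $i_{l+1}, \dots, i_{l+m}$ of the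
  fibre cardinality $N(i_1, \dots, i_{l+m})$, where \<open>i\<close> is the tuple $(i_1, \dots, i_l)$.
\<close>

primrec fibre_sum ::
    "(nat \<Rightarrow> nat) \<Rightarrow> (nat \<Rightarrow> nat) set \<Rightarrow> nat \<Rightarrow> nat \<Rightarrow> (nat \<Rightarrow> nat) \<Rightarrow> nat" where
  "fibre_sum n D 0 l i = card (fibre n D l i)"
| "fibre_sum n D (Suc m) l i = (\<Sum>j\<in>fibre n D l i. fibre_sum n D m (Suc l) (i(Suc l := j)))"

text \<open>
  For $1 \le k \le d - 2$ the sum runs over the $d - 1 - k$ indices $i_{k+1}, \dots, i_{d-1}$;
  for $k = d - 1$ there is no summation and only the fibre cardinality remains.
\<close>

definition N_max :: "nat \<Rightarrow> (nat \<Rightarrow> nat) \<Rightarrow> (nat \<Rightarrow> nat) set \<Rightarrow> nat \<Rightarrow> nat" where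
  "N_max d n D k = Max (fibre_sum n D (d - 1 - k) k ` digit_proj k D)"

definition N_min :: "nat \<Rightarrow> (nat \<Rightarrow> nat) \<Rightarrow> (nat \<Rightarrow> nat) set \<Rightarrow> nat \<Rightarrow> nat" where
  "N_min d n D k = Min (fibre_sum n D (d - 1 - k) k ` digit_proj k D)"

end

theory Submission
  imports Defs
begin

text \<open>
  Cut \<open>F\<close> into approximate cubes of size \<open>R\<close>: fix the first \<open>log(1/R) / log n\<^sub>q\<close> digits of the
  \<open>q\<close>-th coordinate. A ball of radius \<open>R\<close> meets boundedly many of them, so covering numbers are
  comparable to the number of approximate \<open>r\<close>-cubes in an approximate \<open>R\<close>-cube. Digits at
  different positions \<open>k\<close> are independent, so this number is a product over \<open>k\<close>: if \<open>s\<close>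
  coordinates are fixed by the \<open>R\<close>-cube at position \<open>k\<close> and \<open>t\<close> are seen by the \<open>r\<close>-cubes, the
  \<open>k\<close>-th factor is the number of extensions of an \<open>s\<close>-tuple to a \<open>t\<close>-tuple, and each factor can
  be maximised or minimised separately. For \<open>\<theta> \<le> log n\<^sub>1 / log n\<^sub>d\<close> and \<open>r = R powr (1 / \<theta>)\<close> every position has
  \<open>s = 0\<close> or \<open>t = d\<close>, which gives the explicit formulae; for large \<open>\<theta>\<close> every position has
  \<open>t \<le> s + 1\<close>, and then the extremal products also bound the counts at all pairs of scales.
  For the lower spectrum the point must also stay away from richer neighbouring cubes, which a
  bounded number of wasted digits achieves.
\<close>

section \<open>Covering numbers\<close>

text \<open>Exponents ignore constant factors, so three losses are harmless: rounding a depth to an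
  integer, changing a radius by a constant, and replacing a ball by boundedly many cubes. A loss at
  an unbounded number of positions is not harmless, so cube counts are kept as exact products until
  logarithms are taken. The thresholds for \<theta> compare depths: coordinate \<open>q\<close> is
  fixed to depth about \<open>log(1/R) / log n\<^sub>q\<close> at scale \<open>R\<close>, and to
  \<open>1/\<theta>\<close> times that at scale \<open>r\<close>. Small \<theta> puts the depth of
  the last coordinate at \<open>r\<close> beyond that of the first at \<open>R\<close>; large
  \<theta> puts the depth of coordinate \<open>q + 1\<close> at \<open>r\<close> below that of
  coordinate \<open>q\<close> at \<open>R\<close>. Extensions through several coordinates number at
  most the product of the one-step maxima and at least that of the one-step minima, in general
  without equality. Equality for \<open>t \<le> s + 1\<close> is what lets a single family of scale
  pairs decide the Assouad and lower dimensions.\<close>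

lemma covering_number_le:
  assumes "finite C" "E \<subseteq> (\<Union>x\<in>C. cball x r)"
  shows "covering_number E r \<le> card C"
  unfolding covering_number_def using assms by (intro Least_le) blast

lemma covering_number_cover:
  fixes E :: "'a::euclidean_space set"
  assumes "bounded E" "r > 0"
  obtains C where "finite C" "card C = covering_number E r" "E \<subseteq> (\<Union>x\<in>C. cball x r)"
proof -
  have "compact (closure E)" using assms by simp
  then obtain k where k: "finite k" "closure E \<subseteq> (\<Union>x\<in>k. ball x r)"
    using assms(2) unfolding compact_eq_totally_bounded by blast
  have "(\<Union>x\<in>k. ball x r) \<subseteq> (\<Union>x\<in>k. cball x r)" by (intro UN_mono ball_subset_cball) simp
  then have "E \<subseteq> (\<Union>x\<in>k. cball x r)" using k(2) closure_subset[of E] by (meson subset_trans)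
  then have "\<exists>C. finite C \<and> card C = card k \<and> E \<subseteq> (\<Union>x\<in>C. cball x r)" using k(1) by (intro exI[of _ k]) simp
  from LeastI[of "\<lambda>k. \<exists>C. finite C \<and> card C = k \<and> E \<subseteq> (\<Union>x\<in>C. cball x r)", OF this]
  show thesis using that unfolding covering_number_def by auto
qed

lemma covering_number_ge_1:
  fixes E :: "'a::euclidean_space set"
  assumes "bounded E" "E \<noteq> {}" "r > 0"
  shows "covering_number E r \<ge> 1"
proof -
  obtain C where "finite C" "card C = covering_number E r" "E \<subseteq> (\<Union>x\<in>C. cball x r)"
    using covering_number_cover assms by blast
  then show ?thesis using assms(2) by (cases "C = {}") (auto simp: Suc_le_eq card_gt_0_iff)
qed

text \<open>Every ball of radius \<open>\<kappa> * r\<close> is a scaled translate of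
  \<open>cball 0 \<kappa>\<close>, so one fixed cover by unit balls can be transported into each of
  them. Hence covering radii may be changed by constant factors throughout.\<close>

lemma covering_number_doubling:
  fixes E :: "'a::euclidean_space set"
  assumes "bounded E" "r > 0" "\<kappa> > 0"
  shows "covering_number E r \<le> covering_number (cball (0::'a) \<kappa>) 1 * covering_number E (\<kappa> * r)"
proof -
  obtain B where B: "finite B" "card B = covering_number (cball (0::'a) \<kappa>) 1"
      "cball (0::'a) \<kappa> \<subseteq> (\<Union>x\<in>B. cball x 1)"
    using covering_number_cover[of "cball (0::'a) \<kappa>" 1] by auto
  obtain C where C: "finite C" "card C = covering_number E (\<kappa> * r)" "E \<subseteq> (\<Union>x\<in>C. cball x (\<kappa> * r))"
    using covering_number_cover[of E "\<kappa> * r"] assms by auto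
  let ?S = "(\<lambda>(b, c). c + r *\<^sub>R b) ` (B \<times> C)"
  have "E \<subseteq> (\<Union>x\<in>?S. cball x r)"
  proof
    fix x assume "x \<in> E"
    then obtain c where c: "c \<in> C" "x \<in> cball c (\<kappa> * r)" using C(3) by blast
    have "norm (x - c) \<le> \<kappa> * r" using c(2) by (simp add: dist_norm norm_minus_commute)
    moreover have "norm ((1 / r) *\<^sub>R (x - c)) = norm (x - c) / r" using assms by simp
    ultimately have "norm ((1 / r) *\<^sub>R (x - c)) \<le> \<kappa>" using assms by (simp add: pos_divide_le_eq)
    then have "(1 / r) *\<^sub>R (x - c) \<in> cball 0 \<kappa>" by (simp only: mem_cball_0)
    then have "(1 / r) *\<^sub>R (x - c) \<in> (\<Union>x\<in>B. cball x 1)" using B(3) by (rule set_rev_mp)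
    then obtain b where b: "b \<in> B" "dist b ((1 / r) *\<^sub>R (x - c)) \<le> 1" by (auto simp only: mem_cball UN_iff)
    have "(c + r *\<^sub>R b) - x = r *\<^sub>R (b - (1 / r) *\<^sub>R (x - c))"
      using assms by (simp add: algebra_simps)
    then have "dist (c + r *\<^sub>R b) x = r * dist b ((1 / r) *\<^sub>R (x - c))"
      unfolding dist_norm using assms by simp
    also have "\<dots> \<le> r" using b(2) assms by simp
    finally have "x \<in> cball (c + r *\<^sub>R b) r" by simp
    moreover have "c + r *\<^sub>R b \<in> ?S" using b(1) c(1) by auto
    ultimately show "x \<in> (\<Union>x\<in>?S. cball x r)" by blast
  qed
  then have "covering_number E r \<le> card ?S" using B(1) C(1) by (intro covering_number_le) auto
  also have "\<dots> \<le> card (B \<times> C)" using B(1) C(1) by (intro card_image_le) auto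
  finally show ?thesis using B C by (simp add: card_cartesian_product)
qed


section \<open>Exponents of the spectra\<close>

lemma powr_scale_quotient:
  fixes R :: real
  assumes "R > 0"
  shows "R / R powr (1 / \<theta>) = R powr (1 - 1 / \<theta>)"
  using assms by (simp add: powr_diff)

text \<open>The quotient is \<open>R powr (1 - 1 / \<theta>)\<close>, which tends to infinity as
  \<open>R\<close> tends to 0; a negative \<open>u\<close> would drive the right side to 0. Applied
  to a difference of exponents, this compares two power bounds.\<close>

lemma exponent_nonneg:
  fixes c K u \<theta> \<delta> :: real
  assumes \<theta>: "0 < \<theta>" "\<theta> < 1" and "c > 0" "\<delta> > 0"
    and le: "\<And>R. 0 < R \<Longrightarrow> R < \<delta> \<Longrightarrow> c \<le> K * (R / R powr (1 / \<theta>)) powr u"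
  shows "u \<ge> 0"
proof (rule ccontr)
  assume "\<not> u \<ge> 0"
  define p where "p = (1 - 1 / \<theta>) * u"
  have "1 - 1 / \<theta> < 0" using \<theta> by (simp add: field_simps)
  then have p: "p > 0" using \<open>\<not> u \<ge> 0\<close> by (simp add: p_def mult_neg_neg)
  have le': "c \<le> K * R powr p" if "0 < R" "R < \<delta>" for R
    using le[OF that] that by (simp add: powr_scale_quotient powr_powr p_def)
  have "K > 0"
  proof (rule ccontr)
    assume "\<not> K > 0"
    then have "K * (\<delta> / 2) powr p \<le> 0" by (intro mult_nonpos_nonneg) auto
    then show False using le'[of "\<delta> / 2"] assms(3,4) by simp
  qed
  \<comment> \<open>The second entry of the minimum solves \<open>K * R powr p = c / 2\<close>, half
    of what the assumed bound requires.\<close>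
  define R where "R = min (\<delta> / 2) ((c / (2 * K)) powr (1 / p))"
  have R: "0 < R" "R < \<delta>" using assms(3,4) \<open>K > 0\<close> by (auto simp: R_def min_less_iff_disj)
  have "R powr p \<le> ((c / (2 * K)) powr (1 / p)) powr p"
    using R p by (intro powr_mono2) (auto simp: R_def)
  also have "\<dots> = c / (2 * K)" using p \<open>K > 0\<close> \<open>c > 0\<close> by (simp add: powr_powr)
  finally have "K * R powr p \<le> c / 2" using \<open>K > 0\<close> by (simp add: field_simps)
  with le'[OF R] \<open>c > 0\<close> show False by simp
qed

lemma scale_quotient_ge_1:
  fixes R :: real
  assumes "0 < \<theta>" "\<theta> < 1" "0 < R" "R < 1"
  shows "R / R powr (1 / \<theta>) \<ge> 1" "0 < R powr (1 / \<theta>)" "R powr (1 / \<theta>) < R"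
proof -
  have "R powr (1 / \<theta>) < R powr 1" using assms by (intro powr_less_mono') (auto simp: field_simps)
  then show "R powr (1 / \<theta>) < R" using assms by simp
  then show "R / R powr (1 / \<theta>) \<ge> 1" using assms by (simp add: field_simps)
qed (use assms in simp)

lemma Inf_pos_ge:
  fixes t :: real
  assumes "t \<ge> 0"
  shows "Inf {s. s > 0 \<and> s \<ge> t} = t"
proof (cases "t = 0")
  case True
  then have "{s. s > 0 \<and> s \<ge> t} = {0<..}" by auto
  then show ?thesis using True by simp
next
  case False
  then have "{s. s > 0 \<and> s \<ge> t} = {t..}" using assms by auto
  then show ?thesis by simp
qed

text \<open>At \<open>t = 0\<close> the set is empty because exponents are required to be positive,
  and the convention on empty suprema gives the right value.\<close>

lemma Sup0_pos_le:
  fixes t :: real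
  assumes "t \<ge> 0"
  shows "Sup0 {s. s > 0 \<and> s \<le> t} = t"
proof (cases "t = 0")
  case True
  then have "{s. s > 0 \<and> s \<le> t} = {}" by auto
  then show ?thesis using True by (simp add: Sup0_def)
next
  case False
  then have "{s. s > 0 \<and> s \<le> t} = {0<..t}" using assms by auto
  then show ?thesis using False assms by (simp add: Sup0_def)
qed

lemma covering_number_ball_ge_1:
  assumes "x \<in> F" "0 < R" "0 < r"
  shows "covering_number (cball x R \<inter> F) r \<ge> 1"
proof (rule covering_number_ge_1)
  have "x \<in> cball x R \<inter> F" using assms by simp
  then show "cball x R \<inter> F \<noteq> {}" by blast
qed (use assms in \<open>auto simp: bounded_Int\<close>)

lemma powr_exponent_diff_le:
  fixes y :: real
  assumes "y > 0" "a * y powr s \<le> b * y powr t"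
  shows "a \<le> b * y powr (t - s)"
  using assms by (simp add: powr_diff pos_le_divide_eq)

text \<open>The upper bound must hold at every point, the lower one only at some point for each
  small scale. The set of admissible exponents is itself a conclusion, since the Assouad dimension
  is later obtained by comparison with it.\<close>

lemma assouad_spectrum_set:
  fixes F :: "'a::euclidean_space set"
  assumes \<theta>: "0 < \<theta>" "\<theta> < 1" and F: "F \<noteq> {}" and K: "K > 0" "c > 0" "\<delta> > 0"
    and upper: "\<And>R x. 0 < R \<Longrightarrow> R < 1 \<Longrightarrow> x \<in> F \<Longrightarrow>
        real (covering_number (cball x R \<inter> F) (R powr (1 / \<theta>))) \<le> K * (R / R powr (1 / \<theta>)) powr t"
    and lower: "\<And>R. 0 < R \<Longrightarrow> R < \<delta> \<Longrightarrow> \<exists>x\<in>F.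
        c * (R / R powr (1 / \<theta>)) powr t \<le> real (covering_number (cball x R \<inter> F) (R powr (1 / \<theta>)))"
  shows "t \<ge> 0"
    and "{s. s > 0 \<and> (\<exists>C>0. \<forall>R. 0 < R \<and> R < 1 \<longrightarrow> (\<forall>x\<in>F.
     real (covering_number (cball x R \<inter> F) (R powr (1 / \<theta>)))
       \<le> C * (R / R powr (1 / \<theta>)) powr s))} = {s. s > 0 \<and> s \<ge> t}"
    and "assouad_spectrum \<theta> F = t"
proof -
  obtain x0 where x0: "x0 \<in> F" using F by blast
  show t: "t \<ge> 0"
  proof (rule exponent_nonneg[OF \<theta>, of 1 1 K])
    fix R :: real assume R: "0 < R" "R < 1"
    have "1 \<le> real (covering_number (cball x0 R \<inter> F) (R powr (1 / \<theta>)))"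
      using covering_number_ball_ge_1[OF x0 R(1), of "R powr (1 / \<theta>)"] R by simp
    then show "1 \<le> K * (R / R powr (1 / \<theta>)) powr t" using upper[OF R x0] by linarith
  qed auto
  show S: "{s. s > 0 \<and> (\<exists>C>0. \<forall>R. 0 < R \<and> R < 1 \<longrightarrow> (\<forall>x\<in>F.
     real (covering_number (cball x R \<inter> F) (R powr (1 / \<theta>)))
       \<le> C * (R / R powr (1 / \<theta>)) powr s))} = {s. s > 0 \<and> s \<ge> t}" (is "?L = ?R")
  proof (intro set_eqI iffI)
    fix s assume "s \<in> ?L"
    then obtain C where s: "s > 0" and C: "C > 0" "\<And>R x. 0 < R \<Longrightarrow> R < 1 \<Longrightarrow> x \<in> F \<Longrightarrow>
        real (covering_number (cball x R \<inter> F) (R powr (1 / \<theta>))) \<le> C * (R / R powr (1 / \<theta>)) powr s"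
      by auto
    have "s - t \<ge> 0"
    proof (rule exponent_nonneg[OF \<theta>, of c "min \<delta> 1" C])
      fix R :: real assume R: "0 < R" "R < min \<delta> 1"
      obtain x where x: "x \<in> F"
        "c * (R / R powr (1 / \<theta>)) powr t \<le> real (covering_number (cball x R \<inter> F) (R powr (1 / \<theta>)))"
        using lower[of R] R by auto
      have "c * (R / R powr (1 / \<theta>)) powr t \<le> C * (R / R powr (1 / \<theta>)) powr s"
        using C(2)[of R x] R x by simp
      then show "c \<le> C * (R / R powr (1 / \<theta>)) powr (s - t)"
        using R by (intro powr_exponent_diff_le) auto
    qed (use K in auto)
    then show "s \<in> ?R" using s by simp
  next
    fix s assume s: "s \<in> ?R"
    have "real (covering_number (cball x R \<inter> F) (R powr (1 / \<theta>))) \<le> K * (R / R powr (1 / \<theta>)) powr s"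
      if "0 < R" "R < 1" "x \<in> F" for R x
    proof -
      have "(R / R powr (1 / \<theta>)) powr t \<le> (R / R powr (1 / \<theta>)) powr s"
        using scale_quotient_ge_1[OF \<theta> that(1,2)] s by (intro powr_mono) auto
      from mult_left_mono[OF this less_imp_le[OF K(1)]] show ?thesis using upper[OF that] by linarith
    qed
    then show "s \<in> ?L" using s K by auto
  qed
  show "assouad_spectrum \<theta> F = t" unfolding assouad_spectrum_def S by (rule Inf_pos_ge[OF t])
qed

lemma lower_spectrum_set:
  fixes F :: "'a::euclidean_space set"
  assumes \<theta>: "0 < \<theta>" "\<theta> < 1" and K: "K > 0" "c > 0" "\<delta> > 0"
    and lower: "\<And>R x. 0 < R \<Longrightarrow> R < 1 \<Longrightarrow> x \<in> F \<Longrightarrow>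
        c * (R / R powr (1 / \<theta>)) powr t \<le> real (covering_number (cball x R \<inter> F) (R powr (1 / \<theta>)))"
    and upper: "\<And>R. 0 < R \<Longrightarrow> R < \<delta> \<Longrightarrow> \<exists>x\<in>F.
        real (covering_number (cball x R \<inter> F) (R powr (1 / \<theta>))) \<le> K * (R / R powr (1 / \<theta>)) powr t"
  shows "t \<ge> 0"
    and "{s. s > 0 \<and> (\<exists>C>0. \<forall>R. 0 < R \<and> R < 1 \<longrightarrow> (\<forall>x\<in>F.
     real (covering_number (cball x R \<inter> F) (R powr (1 / \<theta>)))
       \<ge> C * (R / R powr (1 / \<theta>)) powr s))} = {s. s > 0 \<and> s \<le> t}"
    and "lower_spectrum \<theta> F = t"
proof -
  show t: "t \<ge> 0"
  proof (rule exponent_nonneg[OF \<theta>, of 1 \<delta> K])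
    fix R :: real assume R: "0 < R" "R < \<delta>"
    then obtain x where x: "x \<in> F"
      "real (covering_number (cball x R \<inter> F) (R powr (1 / \<theta>))) \<le> K * (R / R powr (1 / \<theta>)) powr t"
      using upper by blast
    have "1 \<le> real (covering_number (cball x R \<inter> F) (R powr (1 / \<theta>)))"
      using covering_number_ball_ge_1[OF x(1) R(1), of "R powr (1 / \<theta>)"] R by simp
    then show "1 \<le> K * (R / R powr (1 / \<theta>)) powr t" using x by linarith
  qed (use K in auto)
  show S: "{s. s > 0 \<and> (\<exists>C>0. \<forall>R. 0 < R \<and> R < 1 \<longrightarrow> (\<forall>x\<in>F.
     real (covering_number (cball x R \<inter> F) (R powr (1 / \<theta>)))
       \<ge> C * (R / R powr (1 / \<theta>)) powr s))} = {s. s > 0 \<and> s \<le> t}" (is "?L = ?R")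
  proof (intro set_eqI iffI)
    fix s assume "s \<in> ?L"
    then obtain C where s: "s > 0" and C: "C > 0" "\<And>R x. 0 < R \<Longrightarrow> R < 1 \<Longrightarrow> x \<in> F \<Longrightarrow>
        C * (R / R powr (1 / \<theta>)) powr s \<le> real (covering_number (cball x R \<inter> F) (R powr (1 / \<theta>)))"
      by auto
    have "t - s \<ge> 0"
    proof (rule exponent_nonneg[OF \<theta>, of C "min \<delta> 1" K])
      fix R :: real assume R: "0 < R" "R < min \<delta> 1"
      obtain x where x: "x \<in> F"
        "real (covering_number (cball x R \<inter> F) (R powr (1 / \<theta>))) \<le> K * (R / R powr (1 / \<theta>)) powr t"
        using upper[of R] R by auto
      have "C * (R / R powr (1 / \<theta>)) powr s \<le> K * (R / R powr (1 / \<theta>)) powr t"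
        using C(2)[of R x] R x by simp
      then show "C \<le> K * (R / R powr (1 / \<theta>)) powr (t - s)"
        using R by (intro powr_exponent_diff_le) auto
    qed (use K C in auto)
    then show "s \<in> ?R" using s by simp
  next
    fix s assume s: "s \<in> ?R"
    have "c * (R / R powr (1 / \<theta>)) powr s \<le> real (covering_number (cball x R \<inter> F) (R powr (1 / \<theta>)))"
      if "0 < R" "R < 1" "x \<in> F" for R x
    proof -
      have "(R / R powr (1 / \<theta>)) powr s \<le> (R / R powr (1 / \<theta>)) powr t"
        using scale_quotient_ge_1[OF \<theta> that(1,2)] s by (intro powr_mono) auto
      from mult_left_mono[OF this less_imp_le[OF K(2)]] show ?thesis using lower[OF that] by linarith
    qed
    then show "s \<in> ?L" using s K by auto
  qed
  show "lower_spectrum \<theta> F = t" unfolding lower_spectrum_def S by (rule Sup0_pos_le[OF t])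
qed

text \<open>An exponent admissible for all pairs of scales is admissible for the pairs
  \<open>(R, R powr (1 / \<theta>))\<close>, hence at least \<open>t\<close>. Conversely the bound
  at all scales makes \<open>t\<close> and everything above it admissible, so both infima are over
  the same set.\<close>

lemma assouad_dim_eqI:
  fixes F :: "'a::euclidean_space set"
  assumes \<theta>: "0 < \<theta>" "\<theta> < 1" and F: "F \<noteq> {}" and K: "K > 0" "c > 0" "\<delta> > 0"
    and upper: "\<And>r R x. 0 < r \<Longrightarrow> r < R \<Longrightarrow> x \<in> F \<Longrightarrow>
        real (covering_number (cball x R \<inter> F) r) \<le> K * (R / r) powr t"
    and lower: "\<And>R. 0 < R \<Longrightarrow> R < \<delta> \<Longrightarrow> \<exists>x\<in>F.
        c * (R / R powr (1 / \<theta>)) powr t \<le> real (covering_number (cball x R \<inter> F) (R powr (1 / \<theta>)))"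
  shows "assouad_spectrum \<theta> F = t" "assouad_dim F = t"
proof -
  have up: "real (covering_number (cball x R \<inter> F) (R powr (1 / \<theta>))) \<le> K * (R / R powr (1 / \<theta>)) powr t"
    if "0 < R" "R < 1" "x \<in> F" for R x
    using upper scale_quotient_ge_1[OF \<theta> that(1,2)] that by blast
  note S = assouad_spectrum_set[OF \<theta> F K up lower]
  show "assouad_spectrum \<theta> F = t" by (rule S(3))
  have "{s. s > 0 \<and> (\<exists>C>0. \<forall>x\<in>F. \<forall>r R. 0 < r \<and> r < R \<longrightarrow>
     real (covering_number (cball x R \<inter> F) r) \<le> C * (R / r) powr s)} = {s. s > 0 \<and> s \<ge> t}"
    (is "?A = _")
  proof (intro antisym subsetI)
    fix s assume "s \<in> ?A"
    then obtain C where s: "s > 0" and C: "C > 0" "\<And>r R x. 0 < r \<Longrightarrow> r < R \<Longrightarrow> x \<in> F \<Longrightarrow>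
      real (covering_number (cball x R \<inter> F) r) \<le> C * (R / r) powr s" by blast
    have "\<exists>C>0. \<forall>R. 0 < R \<and> R < 1 \<longrightarrow> (\<forall>x\<in>F.
     real (covering_number (cball x R \<inter> F) (R powr (1 / \<theta>)))
       \<le> C * (R / R powr (1 / \<theta>)) powr s)"
      using C scale_quotient_ge_1[OF \<theta>] by blast
    then show "s \<in> {s. s > 0 \<and> s \<ge> t}" using s S(2) by blast
  next
    fix s assume s: "s \<in> {s. s > 0 \<and> s \<ge> t}"
    have "real (covering_number (cball x R \<inter> F) r) \<le> K * (R / r) powr s"
      if "0 < r" "r < R" "x \<in> F" for r R x
    proof -
      have "(R / r) powr t \<le> (R / r) powr s"
        using that s by (intro powr_mono) auto
      from mult_left_mono[OF this less_imp_le[OF K(1)]] show ?thesis using upper[OF that] by linarith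
    qed
    then show "s \<in> ?A" using s K by blast
  qed
  then show "assouad_dim F = t" unfolding assouad_dim_def using Inf_pos_ge[OF S(1)] by simp
qed

lemma lower_dim_eqI:
  fixes F :: "'a::euclidean_space set"
  assumes \<theta>: "0 < \<theta>" "\<theta> < 1" and K: "K > 0" "c > 0" "\<delta> > 0"
    and lower: "\<And>r R x. 0 < r \<Longrightarrow> r < R \<Longrightarrow> R < 1 \<Longrightarrow> x \<in> F \<Longrightarrow>
        c * (R / r) powr t \<le> real (covering_number (cball x R \<inter> F) r)"
    and upper: "\<And>R. 0 < R \<Longrightarrow> R < \<delta> \<Longrightarrow> \<exists>x\<in>F.
        real (covering_number (cball x R \<inter> F) (R powr (1 / \<theta>))) \<le> K * (R / R powr (1 / \<theta>)) powr t"
  shows "lower_spectrum \<theta> F = t" "lower_dim F = t"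
proof -
  have lo: "c * (R / R powr (1 / \<theta>)) powr t \<le> real (covering_number (cball x R \<inter> F) (R powr (1 / \<theta>)))"
    if "0 < R" "R < 1" "x \<in> F" for R x
    using lower scale_quotient_ge_1[OF \<theta> that(1,2)] that by blast
  note S = lower_spectrum_set[OF \<theta> K lo upper]
  show "lower_spectrum \<theta> F = t" by (rule S(3))
  have "{s. s > 0 \<and> (\<exists>C>0. \<forall>x\<in>F. \<forall>r R. 0 < r \<and> r < R \<and> R < 1 \<longrightarrow>
     real (covering_number (cball x R \<inter> F) r) \<ge> C * (R / r) powr s)} = {s. s > 0 \<and> s \<le> t}"
    (is "?A = _")
  proof (intro antisym subsetI)
    fix s assume "s \<in> ?A"
    then obtain C where s: "s > 0" and C: "C > 0" "\<And>r R x. 0 < r \<Longrightarrow> r < R \<Longrightarrow> R < 1 \<Longrightarrow> x \<in> F \<Longrightarrow>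
      real (covering_number (cball x R \<inter> F) r) \<ge> C * (R / r) powr s" by blast
    have "\<exists>C>0. \<forall>R. 0 < R \<and> R < 1 \<longrightarrow> (\<forall>x\<in>F.
     real (covering_number (cball x R \<inter> F) (R powr (1 / \<theta>)))
       \<ge> C * (R / R powr (1 / \<theta>)) powr s)"
      using C scale_quotient_ge_1[OF \<theta>] by blast
    then show "s \<in> {s. s > 0 \<and> s \<le> t}" using s S(2) by blast
  next
    fix s assume s: "s \<in> {s. s > 0 \<and> s \<le> t}"
    have "c * (R / r) powr s \<le> real (covering_number (cball x R \<inter> F) r)"
      if "0 < r" "r < R" "R < 1" "x \<in> F" for r R x
    proof -
      have "(R / r) powr s \<le> (R / r) powr t"
        using that s by (intro powr_mono) auto
      from mult_left_mono[OF this less_imp_le[OF K(2)]] show ?thesis using lower[OF that] by linarith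
    qed
    then show "s \<in> ?A" using s K by blast
  qed
  then show "lower_dim F = t" unfolding lower_dim_def using Sup0_pos_le[OF S(1)] by simp
qed

section \<open>Counting digit words\<close>

text \<open>Only the first \<open>s\<close> entries of \<open>e\<close> matter, so \<open>e\<close>
  may be a full tuple or a truncated one. For \<open>t = s + 1\<close> this is the fibre cardinality
  N(i_1, ..., i_s) of the prefix of \<open>e\<close>.\<close>

definition ext_count :: "(nat \<Rightarrow> nat) set \<Rightarrow> nat \<Rightarrow> nat \<Rightarrow> (nat \<Rightarrow> nat) \<Rightarrow> nat" where
  "ext_count D s t e =
     card ((\<lambda>i. restrict i {1..t}) ` {i \<in> D. restrict i {1..s} = restrict e {1..s}})"

definition ext_max :: "(nat \<Rightarrow> nat) set \<Rightarrow> nat \<Rightarrow> nat \<Rightarrow> nat" where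
  "ext_max D s t = Max (ext_count D s t ` D)"

definition ext_min :: "(nat \<Rightarrow> nat) set \<Rightarrow> nat \<Rightarrow> nat \<Rightarrow> nat" where
  "ext_min D s t = Min (ext_count D s t ` D)"

lemma restrict_eq_mono:
  assumes "restrict f B = restrict g B" "A \<subseteq> B"
  shows "restrict f A = restrict g A"
proof
  fix x show "restrict f A x = restrict g A x"
    using assms(2) fun_cong[OF assms(1), of x] by (auto simp: restrict_def split: if_splits)
qed

lemma restrict_eq_iff: "restrict f A = restrict g A \<longleftrightarrow> (\<forall>x\<in>A. f x = g x)"
  by (auto simp: restrict_def fun_eq_iff)

lemma ext_count_ge_1: "finite D \<Longrightarrow> e \<in> D \<Longrightarrow> ext_count D s t e \<ge> 1"
  unfolding ext_count_def by (auto simp: Suc_le_eq card_gt_0_iff)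

lemma ext_count_le_card:
  assumes "finite D"
  shows "ext_count D s t e \<le> card D"
proof -
  have "ext_count D s t e \<le> card {i \<in> D. restrict i {1..s} = restrict e {1..s}}"
    unfolding ext_count_def using assms by (intro card_image_le) auto
  also have "\<dots> \<le> card D" using assms by (intro card_mono) auto
  finally show ?thesis .
qed

lemma ext_count_eq_1:
  assumes "e \<in> D" "t \<le> s"
  shows "ext_count D s t e = 1"
proof -
  have "(\<lambda>i. restrict i {1..t}) ` {i \<in> D. restrict i {1..s} = restrict e {1..s}} = {restrict e {1..t}}"
  proof (intro antisym subsetI)
    fix x assume "x \<in> (\<lambda>i. restrict i {1..t}) ` {i \<in> D. restrict i {1..s} = restrict e {1..s}}"
    then obtain i where i: "restrict i {1..s} = restrict e {1..s}" "x = restrict i {1..t}" by blast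
    have "restrict i {1..t} = restrict e {1..t}"
      by (rule restrict_eq_mono[OF i(1)]) (use assms(2) in simp)
    then show "x \<in> {restrict e {1..t}}" using i(2) by simp
  qed (use assms(1) in blast)
  then show ?thesis by (simp add: ext_count_def)
qed

lemma ext_count_0: "ext_count D 0 t e = card (digit_proj t D)"
  by (simp add: ext_count_def digit_proj_def restrict_eq_iff)

text \<open>The \<open>t\<close>-tuples are grouped by their \<open>u\<close>-prefix; an extension
  of such a prefix automatically respects the shorter \<open>s\<close>-prefix.\<close>

lemma ext_count_split:
  assumes "finite D" "s \<le> u" "u \<le> t"
  shows "ext_count D s t e = (\<Sum>a\<in>(\<lambda>i. restrict i {1..u}) `
    {i \<in> D. restrict i {1..s} = restrict e {1..s}}. ext_count D u t a)"
proof -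
  let ?E = "{i \<in> D. restrict i {1..s} = restrict e {1..s}}"
  let ?B = "(\<lambda>i. restrict i {1..t}) ` ?E"
  let ?A = "(\<lambda>i. restrict i {1..u}) ` ?E"
  have fin: "finite ?B" "finite ?A" using assms by auto
  have res: "restrict (restrict i {1..t}) {1..u} = restrict i {1..u}" for i :: "nat \<Rightarrow> nat"
    using assms by (simp add: Int_absorb1)
  have sub: "(\<lambda>b. restrict b {1..u}) ` ?B \<subseteq> ?A" unfolding image_image res by simp
  have "card ?B = (\<Sum>a\<in>?A. \<Sum>b\<in>{b\<in>?B. restrict b {1..u} = a}. 1)"
    using sum.group[OF fin sub, of "\<lambda>_. 1::nat"] by simp
  also have "\<dots> = (\<Sum>a\<in>?A. ext_count D u t a)"
  proof (rule sum.cong[OF refl])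
    fix a assume "a \<in> ?A"
    then obtain i0 where i0: "i0 \<in> ?E" "a = restrict i0 {1..u}" by blast
    have "{b\<in>?B. restrict b {1..u} = a} =
        (\<lambda>i. restrict i {1..t}) ` {i \<in> D. restrict i {1..u} = restrict a {1..u}}"
    proof (intro set_eqI iffI)
      fix b assume "b \<in> {b\<in>?B. restrict b {1..u} = a}"
      then show "b \<in> (\<lambda>i. restrict i {1..t}) ` {i \<in> D. restrict i {1..u} = restrict a {1..u}}"
        using res i0 by auto
    next
      fix b assume "b \<in> (\<lambda>i. restrict i {1..t}) ` {i \<in> D. restrict i {1..u} = restrict a {1..u}}"
      then obtain i where i: "i \<in> D" "restrict i {1..u} = restrict i0 {1..u}" "b = restrict i {1..t}"
        using i0 by auto
      have "restrict i {1..s} = restrict i0 {1..s}"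
        using restrict_eq_mono[OF i(2)] assms by auto
      then show "b \<in> {b\<in>?B. restrict b {1..u} = a}"
        using i i0 res by auto
    qed
    then show "(\<Sum>b\<in>{b\<in>?B. restrict b {1..u} = a}. 1) = ext_count D u t a"
      by (simp add: ext_count_def)
  qed
  finally show ?thesis by (simp add: ext_count_def)
qed

lemma ext_count_restrict [simp]: "ext_count D s t (restrict e {Suc 0..s}) = ext_count D s t e"
  by (simp add: ext_count_def)

lemma ext_bounds:
  assumes "finite D" "e \<in> D"
  shows "ext_min D s t \<le> ext_count D s t e" "ext_count D s t e \<le> ext_max D s t"
  using assms by (auto simp: ext_min_def ext_max_def)

lemma ext_attained:
  assumes "finite D" "D \<noteq> {}"
  shows "\<exists>e\<in>D. ext_count D s t e = ext_max D s t" "\<exists>e\<in>D. ext_count D s t e = ext_min D s t"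
proof -
  have "ext_max D s t \<in> ext_count D s t ` D" "ext_min D s t \<in> ext_count D s t ` D"
    unfolding ext_max_def ext_min_def using assms by (auto intro!: Max_in Min_in)
  then show "\<exists>e\<in>D. ext_count D s t e = ext_max D s t" "\<exists>e\<in>D. ext_count D s t e = ext_min D s t"
    by auto
qed

lemma ext_count_step:
  assumes "finite D" "s \<le> t"
  shows "ext_count D s (Suc t) e \<le> ext_count D s t e * ext_max D t (Suc t)"
    and "ext_count D s t e * ext_min D t (Suc t) \<le> ext_count D s (Suc t) e"
proof -
  let ?A = "(\<lambda>i. restrict i {1..t}) ` {i \<in> D. restrict i {1..s} = restrict e {1..s}}"
  have eq: "ext_count D s (Suc t) e = (\<Sum>a\<in>?A. ext_count D t (Suc t) a)"
    using ext_count_split[of D s t "Suc t" e] assms by simp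
  have "ext_min D t (Suc t) \<le> ext_count D t (Suc t) a \<and> ext_count D t (Suc t) a \<le> ext_max D t (Suc t)"
    if "a \<in> ?A" for a
    using that ext_bounds[OF assms(1)] by (auto simp del: restrict_restrict)
  then show "ext_count D s (Suc t) e \<le> ext_count D s t e * ext_max D t (Suc t)"
    and "ext_count D s t e * ext_min D t (Suc t) \<le> ext_count D s (Suc t) e"
    unfolding eq using sum_bounded_above[of ?A "ext_count D t (Suc t)" "ext_max D t (Suc t)"]
      sum_bounded_below[of ?A "ext_min D t (Suc t)" "ext_count D t (Suc t)"]
    by (auto simp: ext_count_def)
qed

text \<open>Coordinates are added one at a time. Equality can fail, because the extremal prefixes of
  different steps need not belong to one tuple; it is automatic when there is at most one
  step.\<close>

lemma ext_count_le_prod: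
  assumes "finite D" "e \<in> D" "s \<le> t"
  shows "ext_count D s t e \<le> (\<Prod>q=Suc s..t. ext_max D (q - 1) q)"
    and "(\<Prod>q=Suc s..t. ext_min D (q - 1) q) \<le> ext_count D s t e"
  using assms(3)
proof (induction t rule: dec_induct)
  case base
  show "ext_count D s s e \<le> (\<Prod>q=Suc s..s. ext_max D (q - 1) q)"
    "(\<Prod>q=Suc s..s. ext_min D (q - 1) q) \<le> ext_count D s s e"
    using ext_count_eq_1[OF assms(2)] by auto
next
  case (step t)
  show "ext_count D s (Suc t) e \<le> (\<Prod>q=Suc s..Suc t. ext_max D (q - 1) q)"
    using order_trans[OF ext_count_step(1)[OF assms(1) step(1), of e]] step by auto
  show "(\<Prod>q=Suc s..Suc t. ext_min D (q - 1) q) \<le> ext_count D s (Suc t) e"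
    using order_trans[OF _ ext_count_step(2)[OF assms(1) step(1), of e]] step by auto
qed

section \<open>Coordinates still resolved at a given position\<close>

definition active :: "nat \<Rightarrow> (nat \<Rightarrow> nat) \<Rightarrow> nat \<Rightarrow> nat" where
  "active d a k = card {q\<in>{1..d}. k < a q}"

lemma down_closed_eq:
  fixes S :: "nat set"
  assumes "S \<subseteq> {1..d}" "\<And>p q. q \<in> S \<Longrightarrow> 1 \<le> p \<Longrightarrow> p \<le> q \<Longrightarrow> p \<in> S"
  shows "S = {1..card S}"
proof (cases "S = {}")
  case False
  have fin: "finite S" using assms(1) finite_subset by blast
  have "S = {1..Max S}"
  proof (intro set_eqI iffI)
    fix x assume "x \<in> S" then show "x \<in> {1..Max S}" using assms(1) fin by auto
  next
    fix x assume "x \<in> {1..Max S}" then show "x \<in> S" using assms(2)[of "Max S" x] Max_in[OF fin False] by auto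
  qed
  then show ?thesis by (metis card_atLeastAtMost diff_Suc_1)
qed auto

text \<open>Depths decrease with the coordinate because larger bases need fewer digits. The
  coordinates resolved at position \<open>k\<close> are therefore an initial segment, and their
  number says which ones they are.\<close>

lemma active_set:
  assumes "antimono_on {1..d} a"
  shows "{q\<in>{1..d}. k < a q} = {1..active d a k}"
  unfolding active_def
  by (rule down_closed_eq[of _ d]) (use assms in \<open>auto simp: monotone_on_def intro: less_le_trans\<close>)

lemma active_iff:
  assumes "antimono_on {1..d} a" "q \<in> {1..d}"
  shows "q \<le> active d a k \<longleftrightarrow> k < a q"
  using active_set[OF assms(1), of k] assms(2) by (auto simp: set_eq_iff)

lemma active_le: "active d a k \<le> d"
  unfolding active_def by (rule order_trans[OF card_mono[of "{1..d}"]]) auto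

text \<open>Summation by parts: \<open>g\<close> is telescoped into its jumps, and the jump at
  \<open>q\<close> is counted at exactly the \<open>a q\<close> positions below the depth of
  coordinate \<open>q\<close>.\<close>

lemma sum_of_active:
  fixes g :: "nat \<Rightarrow> real"
  assumes a: "antimono_on {1..d} a" "\<And>q. q \<in> {1..d} \<Longrightarrow> a q \<le> M"
  shows "(\<Sum>k<M. g (active d a k)) = M * g 0 + (\<Sum>q=1..d. (g q - g (q - 1)) * a q)"
proof -
  have g: "g s = g 0 + (\<Sum>q=1..d. if q \<le> s then g q - g (q - 1) else 0)" if "s \<le> d" for s
  proof -
    have "(\<Sum>q=1..d. if q \<le> s then g q - g (q - 1) else 0) = (\<Sum>q=1..s. g q - g (q - 1))"
      using that by (intro sum.mono_neutral_cong_right) auto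
    also have "\<dots> = g s - g 0" by (induction s) auto
    finally show ?thesis by simp
  qed
  have "(\<Sum>k<M. g (active d a k)) = (\<Sum>k<M. g 0 + (\<Sum>q=1..d. if q \<le> active d a k then g q - g (q - 1) else 0))"
    by (rule sum.cong[OF refl], rule g, rule active_le)
  also have "\<dots> = M * g 0 + (\<Sum>q=1..d. \<Sum>k<M. if q \<le> active d a k then g q - g (q - 1) else 0)"
    by (simp add: sum.distrib sum.swap[of _ "{..<M}"])
  also have "(\<Sum>q=1..d. \<Sum>k<M. if q \<le> active d a k then g q - g (q - 1) else 0)
      = (\<Sum>q=1..d. (g q - g (q - 1)) * a q)"
  proof (rule sum.cong[OF refl])
    fix q assume q: "q \<in> {1..d}"
    have "(\<Sum>k<M. if q \<le> active d a k then g q - g (q - 1) else 0) = (\<Sum>k<M. if k < a q then g q - g (q - 1) else 0)"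
      using active_iff[OF a(1) q] by simp
    also have "\<dots> = (\<Sum>k<a q. g q - g (q - 1))"
      using a(2)[OF q] by (intro sum.mono_neutral_cong_right) auto
    finally show "(\<Sum>k<M. if q \<le> active d a k then g q - g (q - 1) else 0) = (g q - g (q - 1)) * a q"
      by (simp add: mult.commute)
  qed
  finally show ?thesis .
qed

text \<open>Coordinate \<open>q\<close> is unresolved by \<open>a\<close> but resolved by
  \<open>b\<close> exactly at the positions from \<open>a q\<close> to \<open>b q - 1\<close>, so
  exchanging the two sums leaves a depth difference.\<close>

lemma sum_between_active:
  fixes h :: "nat \<Rightarrow> real"
  assumes a: "antimono_on {1..d} a" and b: "antimono_on {1..d} b"
    and le: "\<And>q. q \<in> {1..d} \<Longrightarrow> a q \<le> b q" "\<And>q. q \<in> {1..d} \<Longrightarrow> b q \<le> M"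
  shows "(\<Sum>k<M. \<Sum>q=Suc (active d a k)..active d b k. h q) = (\<Sum>q=1..d. h q * (real (b q) - real (a q)))"
proof -
  have "(\<Sum>k<M. \<Sum>q=Suc (active d a k)..active d b k. h q)
      = (\<Sum>k<M. \<Sum>q=1..d. if a q \<le> k \<and> k < b q then h q else 0)"
  proof (intro sum.cong[OF refl] sum.mono_neutral_cong_left)
    fix k
    show "{Suc (active d a k)..active d b k} \<subseteq> {1..d}" using active_le[of d b k] by auto
    show "\<forall>q\<in>{1..d} - {Suc (active d a k)..active d b k}. (if a q \<le> k \<and> k < b q then h q else 0) = 0"
    proof
      fix q assume "q \<in> {1..d} - {Suc (active d a k)..active d b k}"
      then show "(if a q \<le> k \<and> k < b q then h q else 0) = 0"
        using active_iff[OF a, of q k] active_iff[OF b, of q k] by auto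
    qed
    fix q assume q: "q \<in> {Suc (active d a k)..active d b k}"
    then have "q \<in> {1..d}" using active_le[of d b k] by auto
    then show "h q = (if a q \<le> k \<and> k < b q then h q else 0)"
      using q active_iff[OF a, of q k] active_iff[OF b, of q k] by auto
  qed auto
  also have "\<dots> = (\<Sum>q=1..d. \<Sum>k<M. if a q \<le> k \<and> k < b q then h q else 0)" by (rule sum.swap)
  also have "\<dots> = (\<Sum>q=1..d. h q * (real (b q) - real (a q)))"
  proof (rule sum.cong[OF refl])
    fix q assume q: "q \<in> {1..d}"
    have "(\<Sum>k<M. if a q \<le> k \<and> k < b q then h q else 0) = (\<Sum>k\<in>{a q..<b q}. h q)"
      using le[OF q] by (intro sum.mono_neutral_cong_right) auto
    then show "(\<Sum>k<M. if a q \<le> k \<and> k < b q then h q else 0) = h q * (real (b q) - real (a q))"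
      using le[OF q] by (simp add: of_nat_diff)
  qed
  finally show ?thesis .
qed

section \<open>Digit blocks read as integers\<close>

primrec base_code :: "nat \<Rightarrow> (nat \<Rightarrow> nat) \<Rightarrow> nat \<Rightarrow> nat" where
  "base_code N f 0 = 0"
| "base_code N f (Suc l) = N * base_code N f l + f l"

lemma base_code_less:
  assumes "\<And>k. k < l \<Longrightarrow> f k < N" shows "base_code N f l < N ^ l"
  using assms
proof (induction l)
  case (Suc l)
  then have "base_code N f l + 1 \<le> N ^ l" "f l < N" by (auto simp: Suc_le_eq)
  then have "N * (base_code N f l + 1) \<le> N * N ^ l" by (intro mult_le_mono) auto
  then show ?case using \<open>f l < N\<close> by (simp add: algebra_simps)
qed auto

lemma base_code_eq_iff:
  assumes "\<And>k. k < l \<Longrightarrow> f k < N" "\<And>k. k < l \<Longrightarrow> g k < N"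
  shows "base_code N f l = base_code N g l \<longleftrightarrow> (\<forall>k<l. f k = g k)"
  using assms
proof (induction l)
  case (Suc l)
  have "base_code N f (Suc l) = base_code N g (Suc l) \<longleftrightarrow> base_code N f l = base_code N g l \<and> f l = g l"
  proof
    assume eq: "base_code N f (Suc l) = base_code N g (Suc l)"
    have "base_code N f (Suc l) mod N = f l" "base_code N g (Suc l) mod N = g l"
      "base_code N f (Suc l) div N = base_code N f l" "base_code N g (Suc l) div N = base_code N g l"
      using Suc.prems[of l] by auto
    then show "base_code N f l = base_code N g l \<and> f l = g l" using eq by simp
  qed auto
  then show ?case using Suc by (auto simp: less_Suc_eq)
qed auto

lemma base_code_add:
  "base_code N f (l + m) = N ^ m * base_code N f l + base_code N (\<lambda>k. f (l + k)) m"
  by (induction m) (auto simp: algebra_simps)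

text \<open>The extreme values 0 and \<open>N ^ c - 1\<close> come only from the constant blocks of
  zeros and of largest digits. A block with two different digits therefore keeps a margin of one
  unit on either side, which later keeps a point off the faces of its cube.\<close>

lemma base_code_interior:
  assumes "\<And>k. k < c \<Longrightarrow> f k < N" "i < c" "j < c" "f i \<noteq> f j"
  shows "1 \<le> base_code N f c" "base_code N f c + 2 \<le> N ^ c"
proof -
  have "N > 0" using assms(1)[OF assms(2)] by simp
  have differs: "\<exists>k<c. f k \<noteq> v" for v using assms(2-4) by metis
  have zero: "base_code N (\<lambda>_. 0) c = 0" by (induction c) auto
  have "base_code N f c \<noteq> base_code N (\<lambda>_. 0) c"
    by (subst base_code_eq_iff) (use assms(1) \<open>N > 0\<close> differs[of 0] in auto)
  then show "1 \<le> base_code N f c" using zero by simp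
  have full: "base_code N (\<lambda>_. N - 1) c + 1 = N ^ c"
  proof (induction c)
    case (Suc c)
    have "base_code N (\<lambda>_. N - 1) (Suc c) + 1 = N * (base_code N (\<lambda>_. N - 1) c + 1)"
      using \<open>N > 0\<close> by (simp add: algebra_simps)
    then show ?case by (simp only: Suc power_Suc)
  qed auto
  have "base_code N f c \<noteq> base_code N (\<lambda>_. N - 1) c"
    by (subst base_code_eq_iff) (use assms(1) \<open>N > 0\<close> differs[of "N - 1"] in auto)
  moreover have "base_code N f c < N ^ c" by (rule base_code_less[OF assms(1)])
  ultimately show "base_code N f c + 2 \<le> N ^ c" using full by linarith
qed

lemma card_image_cong_kernel:
  assumes "\<And>x y. x \<in> A \<Longrightarrow> y \<in> A \<Longrightarrow> f x = f y \<longleftrightarrow> g x = g y"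
  shows "card (f ` A) = card (g ` A)"
proof -
  define h where "h = g \<circ> inv_into A f"
  have h: "h (f x) = g x" if "x \<in> A" for x
    using that assms[of "inv_into A f (f x)" x] by (simp add: h_def inv_into_into f_inv_into_f)
  have "bij_betw h (f ` A) (g ` A)"
    unfolding bij_betw_def inj_on_def using h assms by (auto simp: image_image intro!: image_cong)
  then show ?thesis by (rule bij_betw_same_card)
qed

section \<open>Words over the digit set and their cylinders\<close>

locale digit_system =
  fixes d :: nat and n :: "nat \<Rightarrow> nat" and D :: "(nat \<Rightarrow> nat) set"
  assumes d: "d \<ge> 1" and n1: "2 \<le> n 1" and n_mono: "strict_mono_on {1..d} n"
    and D: "D \<subseteq> digit_tuples d n" and D_nonempty: "D \<noteq> {}"
begin

definition words :: "(nat \<Rightarrow> nat \<Rightarrow> nat) set" where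
  "words = UNIV \<rightarrow> D"

text \<open>With \<open>b q\<close> digits kept in coordinate \<open>q\<close>, this names an
  approximate cube by the integer numerators of its lower corner. The restriction to
  \<open>{1..d}\<close> makes equality of codes mean agreement in the actual coordinates
  only.\<close>

definition code :: "(nat \<Rightarrow> nat) \<Rightarrow> (nat \<Rightarrow> nat \<Rightarrow> nat) \<Rightarrow> nat \<Rightarrow> nat" where
  "code b \<omega> = (\<lambda>q\<in>{1..d}. base_code (n q) (\<lambda>k. \<omega> k q) (b q))"

definition cylinder :: "(nat \<Rightarrow> nat) \<Rightarrow> (nat \<Rightarrow> nat \<Rightarrow> nat) \<Rightarrow> (nat \<Rightarrow> nat \<Rightarrow> nat) set" where
  "cylinder a \<omega> = {\<omega>' \<in> words. code a \<omega>' = code a \<omega>}"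

lemma finite_D [simp]: "finite D"
  using D finite_subset[of D "digit_tuples d n"] by (simp add: digit_tuples_def finite_PiE)

lemma n_ge_2: "q \<in> {1..d} \<Longrightarrow> n q \<ge> 2"
  using n1 n_mono strict_mono_onD[OF n_mono, of 1 q] d by (cases "q = 1") auto

lemma n_le: "q \<in> {1..d} \<Longrightarrow> n q \<le> n d"
  using strict_mono_onD[OF n_mono, of q d] by (cases "q = d") auto

lemma ln_n_pos: "q \<in> {1..d} \<Longrightarrow> ln (real (n q)) > 0"
  using n_ge_2 by fastforce

lemma digit_less: "e \<in> D \<Longrightarrow> q \<in> {1..d} \<Longrightarrow> e q < n q"
  using D by (force simp: digit_tuples_def)

lemma word_digit: "\<omega> \<in> words \<Longrightarrow> \<omega> k \<in> D"
  by (auto simp: words_def)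

lemma code_eq_iff:
  assumes "\<omega> \<in> words" "\<omega>' \<in> words"
  shows "code b \<omega> = code b \<omega>' \<longleftrightarrow> (\<forall>q\<in>{1..d}. \<forall>k<b q. \<omega> k q = \<omega>' k q)"
  unfolding code_def restrict_eq_iff
  using base_code_eq_iff digit_less word_digit assms by (intro ball_cong[OF refl]) simp

lemma code_eq_iff_restrict:
  assumes "\<omega> \<in> words" "\<omega>' \<in> words" "antimono_on {1..d} b" "\<And>q. q \<in> {1..d} \<Longrightarrow> b q \<le> M"
  shows "code b \<omega> = code b \<omega>' \<longleftrightarrow>
    (\<forall>k<M. restrict (\<omega> k) {1..active d b k} = restrict (\<omega>' k) {1..active d b k})"
  unfolding code_eq_iff[OF assms(1,2)] restrict_eq_iff active_set[OF assms(3), symmetric]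
proof (intro iffI allI ballI impI)
  fix q k assume eq: "\<forall>k<M. \<forall>q\<in>{q \<in> {1..d}. k < b q}. \<omega> k q = \<omega>' k q" and q: "q \<in> {1..d}" "k < b q"
  then show "\<omega> k q = \<omega>' k q" using assms(4)[OF q(1)] by simp
qed simp

text \<open>Up to renaming, a code is the list of letter prefixes that it records. At each position
  the cylinder prescribes one prefix and the code records another, and words over \<open>D\<close>
  may choose their letters independently, so the image is a full product.\<close>

lemma card_code_cylinder:
  assumes \<omega>: "\<omega> \<in> words"
    and a: "antimono_on {1..d} a" "\<And>q. q \<in> {1..d} \<Longrightarrow> a q \<le> M"
    and b: "antimono_on {1..d} b" "\<And>q. q \<in> {1..d} \<Longrightarrow> b q \<le> M"
  shows "card (code b ` cylinder a \<omega>) = (\<Prod>k<M. ext_count D (active d a k) (active d b k) (\<omega> k))"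
proof -
  let ?s = "active d a" and ?t = "active d b"
  let ?E = "\<lambda>k. {i \<in> D. restrict i {1..?s k} = restrict (\<omega> k) {1..?s k}}"
  let ?p = "\<lambda>\<omega>'. \<lambda>k\<in>{..<M}. restrict (\<omega>' k) {1..?t k}"
  have "card (code b ` cylinder a \<omega>) = card (?p ` cylinder a \<omega>)"
  proof (rule card_image_cong_kernel)
    fix x y assume xy: "x \<in> cylinder a \<omega>" "y \<in> cylinder a \<omega>"
    show "code b x = code b y \<longleftrightarrow> ?p x = ?p y"
      unfolding restrict_eq_iff[of _ "{..<M}"]
      using code_eq_iff_restrict[of x y b M] b xy by (auto simp: cylinder_def)
  qed
  also have "?p ` cylinder a \<omega> = (\<Pi>\<^sub>E k\<in>{..<M}. (\<lambda>i. restrict i {1..?t k}) ` ?E k)"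
  proof (intro set_eqI iffI)
    fix f assume "f \<in> ?p ` cylinder a \<omega>"
    then obtain \<omega>' where w: "\<omega>' \<in> words" "code a \<omega>' = code a \<omega>" "f = ?p \<omega>'"
      by (auto simp: cylinder_def)
    then have "\<forall>k<M. \<omega>' k \<in> ?E k"
      using code_eq_iff_restrict[of \<omega>' \<omega> a M] a \<omega> word_digit by auto
    then show "f \<in> (\<Pi>\<^sub>E k\<in>{..<M}. (\<lambda>i. restrict i {1..?t k}) ` ?E k)" using w(3) by auto
  next
    fix f assume f: "f \<in> (\<Pi>\<^sub>E k\<in>{..<M}. (\<lambda>i. restrict i {1..?t k}) ` ?E k)"
    then have "\<forall>k\<in>{..<M}. \<exists>i. i \<in> ?E k \<and> f k = restrict i {1..?t k}"
      by (auto simp: PiE_iff image_iff)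
    from bchoice[OF this] obtain i where i: "\<forall>k\<in>{..<M}. i k \<in> ?E k \<and> f k = restrict (i k) {1..?t k}"
      by blast
    \<comment> \<open>The tail of \<open>\<omega>\<close> only completes the word; no depth exceeds
      \<open>M\<close>, so neither code sees it.\<close>
    define \<omega>' where "\<omega>' k = (if k < M then i k else \<omega> k)" for k
    have w: "\<omega>' \<in> words" using i \<omega> by (auto simp: words_def \<omega>'_def)
    moreover have "code a \<omega>' = code a \<omega>"
      using code_eq_iff_restrict[of \<omega>' \<omega> a M] a \<omega> w i by (auto simp: \<omega>'_def)
    moreover have "f = ?p \<omega>'"
    proof
      fix k show "f k = ?p \<omega>' k"
      proof (cases "k < M")
        case True
        then have "f k = restrict (i k) {1..?t k}" using i by blast
        then show ?thesis using True by (simp add: \<omega>'_def)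
      next
        case False
        then have "f k = undefined" using f by (intro PiE_arb[of f]) auto
        then show ?thesis using False by simp
      qed
    qed
    ultimately show "f \<in> ?p ` cylinder a \<omega>" by (auto simp: cylinder_def)
  qed
  also have "card \<dots> = (\<Prod>k<M. ext_count D (?s k) (?t k) (\<omega> k))"
    by (simp add: card_PiE ext_count_def)
  finally show ?thesis .
qed

end

section \<open>Nested fibre sums\<close>

context digit_system
begin

lemma fibre_bij:
  assumes "l < d" "e \<in> D"
  shows "bij_betw (\<lambda>j. (restrict e {1..l})(Suc l := j)) (fibre n D l (restrict e {1..l}))
     ((\<lambda>i. restrict i {1..Suc l}) ` {i \<in> D. restrict i {1..l} = restrict e {1..l}})"
    (is "bij_betw ?f ?A ?B")
proof -
  have "inj_on ?f ?A" by (intro inj_onI) (metis fun_upd_same)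
  moreover have "?f ` ?A = ?B"
  proof (intro set_eqI iffI)
    fix x assume "x \<in> ?f ` ?A"
    then obtain j where j: "x = ?f j" "?f j \<in> digit_proj (Suc l) D" by (auto simp: fibre_def)
    then obtain i where i: "i \<in> D" "?f j = restrict i {1..Suc l}" by (auto simp: digit_proj_def)
    have "restrict i {1..l} = restrict (?f j) {1..l}" unfolding i(2) by (simp add: Int_absorb1)
    also have "\<dots> = restrict e {1..l}" by (auto simp: restrict_def)
    finally show "x \<in> ?B" using i j by auto
  next
    fix x assume "x \<in> ?B"
    then obtain i where i: "i \<in> D" "x = restrict i {1..Suc l}" "restrict i {1..l} = restrict e {1..l}"
      by auto
    have x: "x = ?f (i (Suc l))"
      unfolding i(2) i(3)[symmetric] by (auto simp: restrict_def fun_eq_iff le_Suc_eq)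
    have "i (Suc l) < n (Suc l)" using digit_less[OF i(1), of "Suc l"] assms by auto
    moreover have "?f (i (Suc l)) \<in> digit_proj (Suc l) D"
      unfolding x[symmetric] i(2) digit_proj_def using i(1) by (rule imageI)
    ultimately have "i (Suc l) \<in> ?A" by (auto simp: fibre_def)
    then show "x \<in> ?f ` ?A" using x by blast
  qed
  ultimately show ?thesis by (simp add: bij_betw_def)
qed

text \<open>Each level of the nested sum is a splitting of extensions at the next coordinate. With
  \<open>m = d - 1 - k\<close> and \<open>l = k\<close> the target is \<open>d\<close>, so the
  numbers N_k count completions of a \<open>k\<close>-tuple to a full tuple of
  \<open>D\<close>.\<close>

lemma fibre_sum_eq:
  assumes "e \<in> D" "l + m < d"
  shows "fibre_sum n D m l (restrict e {1..l}) = ext_count D l (Suc (l + m)) e"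
  using assms
proof (induction m arbitrary: l e)
  case 0
  then show ?case unfolding fibre_sum.simps ext_count_def add_0_right
    by (intro bij_betw_same_card[OF fibre_bij]) auto
next
  case (Suc m)
  let ?B = "(\<lambda>i. restrict i {1..Suc l}) ` {i \<in> D. restrict i {1..l} = restrict e {1..l}}"
  have "fibre_sum n D (Suc m) l (restrict e {1..l}) = (\<Sum>x\<in>?B. fibre_sum n D m (Suc l) x)"
    using sum.reindex_bij_betw[OF fibre_bij[of l e], of "fibre_sum n D m (Suc l)"] Suc.prems by simp
  also have "\<dots> = (\<Sum>x\<in>?B. ext_count D (Suc l) (Suc (Suc l + m)) x)"
  proof (rule sum.cong[OF refl])
    fix x assume "x \<in> ?B"
    then obtain i where i: "i \<in> D" "x = restrict i {1..Suc l}" by blast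
    show "fibre_sum n D m (Suc l) x = ext_count D (Suc l) (Suc (Suc l + m)) x"
      unfolding i(2) using Suc.IH[OF i(1), of "Suc l"] Suc.prems(2)
      by (simp only: One_nat_def ext_count_restrict add_Suc add_Suc_right)
  qed
  also have "\<dots> = ext_count D l (Suc (l + Suc m)) e"
    using ext_count_split[of D l "Suc l" "Suc (Suc l + m)" e] by simp
  finally show ?case .
qed

lemma N_max_eq: "1 \<le> k \<Longrightarrow> k \<le> d - 1 \<Longrightarrow> N_max d n D k = ext_max D k d"
  and N_min_eq: "1 \<le> k \<Longrightarrow> k \<le> d - 1 \<Longrightarrow> N_min d n D k = ext_min D k d"
proof -
  assume "1 \<le> k" "k \<le> d - 1"
  then have "k + (d - 1 - k) < d" "Suc (k + (d - 1 - k)) = d" by auto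
  then have "fibre_sum n D (d - 1 - k) k ` digit_proj k D = ext_count D k d ` D"
    unfolding digit_proj_def image_image using fibre_sum_eq by (intro image_cong) auto
  then show "N_max d n D k = ext_max D k d" "N_min d n D k = ext_min D k d"
    by (simp_all add: N_max_def N_min_def ext_max_def ext_min_def)
qed

end

section \<open>Approximate cubes\<close>

lemma coord_pos_bij: "bij_betw (coord_pos :: 'd::{finite,linorder} \<Rightarrow> nat) UNIV {1..CARD('d)}"
proof -
  have less: "coord_pos c < coord_pos c'" if "c < c'" for c c' :: 'd
    unfolding coord_pos_def using that by (intro psubset_card_mono) auto
  have "inj (coord_pos :: 'd \<Rightarrow> nat)"
    by (rule injI) (metis less less_irrefl linorder_less_linear)
  moreover have "coord_pos c \<in> {1..CARD('d)}" for c :: 'd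
  proof -
    have "card {..c} \<ge> 1" by (auto simp: Suc_le_eq card_gt_0_iff)
    moreover have "card {..c} \<le> CARD('d)" by (intro card_mono) auto
    ultimately show ?thesis by (simp add: coord_pos_def)
  qed
  moreover from calculation have "range (coord_pos :: 'd \<Rightarrow> nat) = {1..CARD('d)}"
    by (intro card_subset_eq) (auto simp: card_image)
  ultimately show ?thesis by (simp add: bij_betw_def)
qed

text \<open>The dummy type argument fixes the coordinate type \<open>'d\<close>, which occurs in the
  type of none of the other parameters.\<close>

locale sponge_system = digit_system d n D for d n D +
  fixes dim_type :: "'d::{finite,linorder} itself"
  assumes dim: "d = CARD('d)"
begin

abbreviation X :: "(nat \<Rightarrow> nat \<Rightarrow> nat) \<Rightarrow> (real, 'd) vec" where
  "X \<equiv> sponge_point n"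

abbreviation F :: "((real, 'd) vec) set" where
  "F \<equiv> sponge n D"

abbreviation digit_code :: "(nat \<Rightarrow> nat \<Rightarrow> nat) \<Rightarrow> nat \<Rightarrow> nat \<Rightarrow> nat" where
  "digit_code \<omega> q l \<equiv> base_code (n q) (\<lambda>k. \<omega> k q) l"

lemma coord_pos_mem: "coord_pos (c :: 'd) \<in> {1..d}"
  using coord_pos_bij dim by (auto simp: bij_betw_def)

lemma coord_pos_surj: "q \<in> {1..d} \<Longrightarrow> \<exists>c::'d. coord_pos c = q"
  using coord_pos_bij[where 'd='d] dim unfolding bij_betw_def by (metis imageE)

lemma n_pos: "q \<in> {1..d} \<Longrightarrow> n q > 0"
  using n_ge_2 by fastforce

text \<open>Composing the maps is Horner's scheme: in each coordinate the result is one affine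
  contraction whose integer translation is the code of the digits.\<close>

lemma sponge_comp_nth:
  "(sponge_comp n \<omega> l x :: (real, 'd) vec) $ c =
     (real (digit_code \<omega> (coord_pos c) l) + x $ c) / real (n (coord_pos c)) ^ l"
proof (induction l arbitrary: x)
  case (Suc l)
  then show ?case using n_pos[OF coord_pos_mem[of c]]
    by (simp add: sponge_map_def field_simps)
qed auto

lemma mem_sponge_comp_image:
  fixes y :: "(real, 'd) vec"
  shows "y \<in> sponge_comp n \<omega> l ` cbox 0 1 \<longleftrightarrow>
    (\<forall>c. real (digit_code \<omega> (coord_pos c) l) \<le> real (n (coord_pos c)) ^ l * y $ c \<and>
         real (n (coord_pos c)) ^ l * y $ c \<le> real (digit_code \<omega> (coord_pos c) l) + 1)"
proof
  assume "y \<in> sponge_comp n \<omega> l ` cbox 0 1"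
  then obtain x where x: "x \<in> cbox 0 1" "y = sponge_comp n \<omega> l x" by blast
  then show "\<forall>c. real (digit_code \<omega> (coord_pos c) l) \<le> real (n (coord_pos c)) ^ l * y $ c \<and>
         real (n (coord_pos c)) ^ l * y $ c \<le> real (digit_code \<omega> (coord_pos c) l) + 1"
    using n_pos[OF coord_pos_mem] by (auto simp: sponge_comp_nth mem_box_cart)
next
  assume *: "\<forall>c. real (digit_code \<omega> (coord_pos c) l) \<le> real (n (coord_pos c)) ^ l * y $ c \<and>
         real (n (coord_pos c)) ^ l * y $ c \<le> real (digit_code \<omega> (coord_pos c) l) + 1"
  define x :: "(real, 'd) vec" where
    "x = (\<chi> c. real (n (coord_pos c)) ^ l * y $ c - real (digit_code \<omega> (coord_pos c) l))"
  have "x \<in> cbox 0 1" using * by (auto simp: x_def mem_box_cart algebra_simps)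
  moreover have "y = sponge_comp n \<omega> l x"
    using n_pos[OF coord_pos_mem] by (auto simp: vec_eq_iff sponge_comp_nth x_def)
  ultimately show "y \<in> sponge_comp n \<omega> l ` cbox 0 1" by blast
qed

lemma sponge_comp_decreasing:
  assumes "\<omega> \<in> words"
  shows "(sponge_comp n \<omega> (Suc l) :: (real, 'd) vec \<Rightarrow> _) ` cbox 0 1 \<subseteq> sponge_comp n \<omega> l ` cbox 0 1"
proof -
  have "(sponge_map n (\<omega> l) x :: (real, 'd) vec) \<in> cbox 0 1" if "x \<in> cbox 0 1" for x
  proof -
    have "(x $ c + real (\<omega> l (coord_pos c))) / real (n (coord_pos c)) \<le> 1" for c :: 'd
    proof -
      have "x $ c \<le> 1" using that by (auto simp: mem_box_cart)
      moreover have "real (\<omega> l (coord_pos c)) + 1 \<le> real (n (coord_pos c))"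
        using digit_less[OF word_digit[OF assms] coord_pos_mem, of l c] by linarith
      ultimately show ?thesis using n_pos[OF coord_pos_mem[of c]] by simp
    qed
    then show ?thesis using that by (auto simp: mem_box_cart sponge_map_def)
  qed
  then show ?thesis by auto
qed

text \<open>\<open>sponge_point\<close> is a definite description, so existence and uniqueness are
  both needed: nested compact boxes provide a point, and their shrinking sides leave no room for a
  second one.\<close>

lemma sponge_point_mem:
  assumes w: "\<omega> \<in> words"
  shows "X \<omega> \<in> (\<Inter>l. sponge_comp n \<omega> l ` cbox 0 1)"
proof -
  let ?S = "\<lambda>l. (sponge_comp n \<omega> l :: (real, 'd) vec \<Rightarrow> _) ` cbox 0 1"
  have S_eq: "?S l = cbox (\<chi> c. real (digit_code \<omega> (coord_pos c) l) / real (n (coord_pos c)) ^ l)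
      (\<chi> c. (real (digit_code \<omega> (coord_pos c) l) + 1) / real (n (coord_pos c)) ^ l)" for l
  proof (intro set_eqI)
    fix y show "y \<in> ?S l \<longleftrightarrow> y \<in> cbox (\<chi> c. real (digit_code \<omega> (coord_pos c) l) / real (n (coord_pos c)) ^ l)
      (\<chi> c. (real (digit_code \<omega> (coord_pos c) l) + 1) / real (n (coord_pos c)) ^ l)"
      unfolding mem_sponge_comp_image using n_pos[OF coord_pos_mem]
      by (simp add: mem_box_cart pos_divide_le_eq pos_le_divide_eq mult.commute)
  qed
  have "\<Inter> (range ?S) \<noteq> {}"
  proof (rule compact_nest)
    show "compact (?S l)" for l unfolding S_eq by (rule compact_cbox)
    show "?S l \<noteq> {}" for l by (auto simp: interval_ne_empty_cart)
    show "?S m \<subseteq> ?S l" if "l \<le> m" for l m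
      using that by (rule lift_Suc_antimono_le[of ?S, OF sponge_comp_decreasing[OF w]])
  qed
  then obtain x where x: "x \<in> (\<Inter>l. ?S l)" by auto
  have uniq: "y = x" if y: "y \<in> (\<Inter>l. ?S l)" for y
  proof (rule ccontr)
    assume "y \<noteq> x"
    then obtain c where c: "y $ c \<noteq> x $ c" by (auto simp: vec_eq_iff)
    have "real (n (coord_pos c)) > 1" using n_ge_2[OF coord_pos_mem[of c]] by simp
    then obtain l where l: "1 / \<bar>y $ c - x $ c\<bar> < real (n (coord_pos c)) ^ l"
      using real_arch_pow by blast
    have xl: "x \<in> ?S l" and yl: "y \<in> ?S l" using x y by (blast+)
    have "\<bar>real (n (coord_pos c)) ^ l * y $ c - real (n (coord_pos c)) ^ l * x $ c\<bar> \<le> 1"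
      using xl[unfolded mem_sponge_comp_image, THEN spec[of _ c]]
        yl[unfolded mem_sponge_comp_image, THEN spec[of _ c]] by linarith
    then have "real (n (coord_pos c)) ^ l * \<bar>y $ c - x $ c\<bar> \<le> 1"
      by (simp add: abs_mult flip: right_diff_distrib)
    then show False using l c by (simp add: field_simps)
  qed
  show ?thesis unfolding sponge_point_def using theI[of "\<lambda>x. x \<in> (\<Inter>l. ?S l)", OF x uniq] .
qed

text \<open>Both inequalities are weak, since a point may lie on a common face of neighbouring
  cubes. Codes are therefore not functions of the point, and the estimates below allow for an error
  of one unit.\<close>

lemma sponge_point_bounds:
  assumes "\<omega> \<in> words"
  shows "real (digit_code \<omega> (coord_pos c) l) \<le> real (n (coord_pos c)) ^ l * X \<omega> $ c"
    and "real (n (coord_pos c)) ^ l * X \<omega> $ c \<le> real (digit_code \<omega> (coord_pos c) l) + 1"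
  using sponge_point_mem[OF assms] unfolding INT_iff mem_sponge_comp_image by auto

lemma bounded_X: "W \<subseteq> words \<Longrightarrow> bounded (X ` W)"
proof (rule bounded_subset[OF bounded_cbox[of 0 1]], rule image_subsetI)
  fix \<omega> assume "W \<subseteq> words" "\<omega> \<in> W"
  then show "X \<omega> \<in> cbox 0 1"
    using sponge_point_bounds[of \<omega> _ 0] by (auto simp: mem_box_cart)
qed

lemma F_eq: "F = X ` words"
  by (simp add: sponge_def words_def)

lemma cball_F: "cball x R \<inter> F = X ` {\<omega> \<in> words. X \<omega> \<in> cball x R}"
  unfolding F_eq by auto

section \<open>Comparison of balls with approximate cubes\<close>

lemma finite_code: "finite (code b ` W)" if "W \<subseteq> words"
proof (rule finite_subset)
  show "code b ` W \<subseteq> (\<Pi>\<^sub>E q\<in>{1..d}. {..<n q ^ b q})"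
  proof (rule image_subsetI)
    fix \<omega> assume "\<omega> \<in> W"
    then have "digit_code \<omega> q (b q) < n q ^ b q" if "q \<in> {1..d}" for q
      using digit_less[OF word_digit _ ] that \<open>W \<subseteq> words\<close> by (intro base_code_less) blast
    then show "code b \<omega> \<in> (\<Pi>\<^sub>E q\<in>{1..d}. {..<n q ^ b q})" by (auto simp: code_def)
  qed
qed (auto intro!: finite_PiE)

text \<open>After scaling coordinate \<open>q\<close> by \<open>n q ^ a q\<close>, the ball reaches
  at most 1 from its centre and a code lies at most 1 below its point. Codes thus fall into an
  interval of length 3, which holds at most 4 integers.\<close>

lemma card_code_ball:
  assumes "\<And>q. q \<in> {1..d} \<Longrightarrow> a q = 0 \<or> R \<le> 1 / real (n q) ^ a q"
  shows "card (code a ` {\<omega> \<in> words. X \<omega> \<in> cball y R}) \<le> 4 ^ d"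
proof -
  define cc :: "nat \<Rightarrow> 'd" where "cc q = inv coord_pos q" for q
  have cc: "coord_pos (cc q) = q" if "q \<in> {1..d}" for q
    using coord_pos_surj[OF that] unfolding cc_def by (auto intro: f_inv_into_f)
  define u where "u q = real (n q) ^ a q * y $ cc q" for q
  \<comment> \<open>At depth 0 the only code is 0 whatever the radius; treating this case apart
    admits radii above 1.\<close>
  define A where "A q = (if a q = 0 then {0::nat} else {z. u q - 2 \<le> real z \<and> real z \<le> u q + 1})" for q
  have A: "finite (A q) \<and> card (A q) \<le> 4" for q
  proof (cases "a q = 0")
    case False
    have sub: "A q \<subseteq> nat ` {\<lceil>u q - 2\<rceil>..\<lfloor>u q + 1\<rfloor>}"
    proof
      fix z assume "z \<in> A q"
      then have "u q - 2 \<le> of_int (int z)" "of_int (int z) \<le> u q + 1"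
        using False by (auto simp: A_def)
      then have "int z \<in> {\<lceil>u q - 2\<rceil>..\<lfloor>u q + 1\<rfloor>}"
        unfolding atLeastAtMost_iff le_floor_iff ceiling_le_iff by blast
      then have "nat (int z) \<in> nat ` {\<lceil>u q - 2\<rceil>..\<lfloor>u q + 1\<rfloor>}" by (rule imageI)
      then show "z \<in> nat ` {\<lceil>u q - 2\<rceil>..\<lfloor>u q + 1\<rfloor>}" unfolding nat_int .
    qed
    have four: "card (nat ` {\<lceil>u q - 2\<rceil>..\<lfloor>u q + 1\<rfloor>}) \<le> 4"
    proof -
      have "card (nat ` {\<lceil>u q - 2\<rceil>..\<lfloor>u q + 1\<rfloor>}) \<le> card {\<lceil>u q - 2\<rceil>..\<lfloor>u q + 1\<rfloor>}"
        by (intro card_image_le) auto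
      also have "\<dots> \<le> 4" using floor_le_ceiling[of "u q"] by simp linarith
      finally show ?thesis .
    qed
    have fin: "finite (nat ` {\<lceil>u q - 2\<rceil>..\<lfloor>u q + 1\<rfloor>})" by simp
    show ?thesis
      using finite_subset[OF sub fin] order_trans[OF card_mono[OF fin sub] four] by (rule conjI)
  qed (auto simp: A_def)
  have "code a ` {\<omega> \<in> words. X \<omega> \<in> cball y R} \<subseteq> (\<Pi>\<^sub>E q\<in>{1..d}. A q)"
  proof (rule image_subsetI)
    fix \<omega> assume "\<omega> \<in> {\<omega> \<in> words. X \<omega> \<in> cball y R}"
    then have w: "\<omega> \<in> words" and dst: "dist y (X \<omega>) \<le> R" by auto
    have "digit_code \<omega> q (a q) \<in> A q" if q: "q \<in> {1..d}" for q
    proof (cases "a q = 0")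
      case False
      let ?N = "real (n q) ^ a q"
      have N: "?N > 0" using n_pos[OF q] by simp
      have "\<bar>y $ cc q - X \<omega> $ cc q\<bar> \<le> 1 / ?N"
        using dist_vec_nth_le[of y "cc q" "X \<omega>"] dst assms[OF q] False by (auto simp: dist_real_def)
      then have "?N * \<bar>y $ cc q - X \<omega> $ cc q\<bar> \<le> 1" using N by (simp add: field_simps)
      then have "\<bar>u q - ?N * X \<omega> $ cc q\<bar> \<le> 1"
        using N by (simp add: u_def abs_mult flip: right_diff_distrib)
      moreover have "real (digit_code \<omega> q (a q)) \<le> ?N * X \<omega> $ cc q"
        "?N * X \<omega> $ cc q \<le> real (digit_code \<omega> q (a q)) + 1"
        using sponge_point_bounds[OF w, of "cc q" "a q"] unfolding cc[OF q] by auto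
      ultimately have "u q - 2 \<le> real (digit_code \<omega> q (a q))" "real (digit_code \<omega> q (a q)) \<le> u q + 1"
        by linarith+
      then show ?thesis using False unfolding A_def by simp
    qed (simp add: A_def)
    then show "code a \<omega> \<in> (\<Pi>\<^sub>E q\<in>{1..d}. A q)" by (auto simp: code_def)
  qed
  then have "card (code a ` {\<omega> \<in> words. X \<omega> \<in> cball y R}) \<le> card (\<Pi>\<^sub>E q\<in>{1..d}. A q)"
    using A by (intro card_mono finite_PiE) auto
  also have "\<dots> = (\<Prod>q\<in>{1..d}. card (A q))" by (simp add: card_PiE)
  also have "\<dots> \<le> (\<Prod>q\<in>{1..d}. 4)" using A by (intro prod_mono) auto
  finally show ?thesis by simp
qed

lemma dist_X_le:
  assumes w: "\<omega> \<in> words" "\<omega>' \<in> words" and eq: "code a \<omega> = code a \<omega>'"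
    and \<delta>: "\<And>q. q \<in> {1..d} \<Longrightarrow> 1 / real (n q) ^ a q \<le> \<delta>"
  shows "dist (X \<omega>) (X \<omega>') \<le> real d * \<delta>"
proof -
  have "\<bar>(X \<omega> - X \<omega>') $ c\<bar> \<le> \<delta>" for c
  proof -
    let ?q = "coord_pos c"
    let ?N = "real (n ?q) ^ a ?q"
    have q: "?q \<in> {1..d}" by (rule coord_pos_mem)
    have N: "?N > 0" using n_pos[OF q] by simp
    have "digit_code \<omega> ?q (a ?q) = digit_code \<omega>' ?q (a ?q)"
      using fun_cong[OF eq, of ?q] q by (simp add: code_def)
    then have "\<bar>?N * X \<omega> $ c - ?N * X \<omega>' $ c\<bar> \<le> 1"
      using sponge_point_bounds[OF w(1), of c "a ?q"] sponge_point_bounds[OF w(2), of c "a ?q"] by linarith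
    then have "?N * \<bar>X \<omega> $ c - X \<omega>' $ c\<bar> \<le> 1" using N by (simp add: abs_mult flip: right_diff_distrib)
    then have "\<bar>X \<omega> $ c - X \<omega>' $ c\<bar> \<le> 1 / ?N" using N by (simp add: field_simps)
    then show ?thesis using \<delta>[OF q] by simp
  qed
  then have "(\<Sum>c\<in>UNIV. \<bar>(X \<omega> - X \<omega>') $ c\<bar>) \<le> of_nat (card (UNIV :: 'd set)) * \<delta>"
    by (intro sum_bounded_above) auto
  then show ?thesis using norm_le_l1_cart[of "X \<omega> - X \<omega>'"] by (simp add: dist_norm dim)
qed

text \<open>For \<open>R \<le> 1\<close>, \<open>n q ^ lev R q\<close> is the largest power of
  \<open>n q\<close> not exceeding \<open>1 / R\<close>, so the cube sides lie between
  \<open>R\<close> and \<open>n q * R\<close>. For \<open>R > 1\<close> the conversion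
  \<open>nat\<close> sets the depth to 0.\<close>

definition lev :: "real \<Rightarrow> nat \<Rightarrow> nat" where
  "lev R q = nat \<lfloor>ln (1 / R) / ln (real (n q))\<rfloor>"

lemma n_powr_eq: "q \<in> {1..d} \<Longrightarrow> real (n q) ^ k = exp (real k * ln (real (n q)))"
  using n_pos by (simp add: exp_of_nat_mult)

lemma lev_side_ge:
  assumes "R > 0" "q \<in> {1..d}"
  shows "lev R q = 0 \<or> R \<le> 1 / real (n q) ^ lev R q"
proof (cases "lev R q = 0")
  case False
  then have "real (lev R q) \<le> ln (1 / R) / ln (real (n q))" unfolding lev_def by linarith
  then have "real (lev R q) * ln (real (n q)) \<le> ln (1 / R)"
    using ln_n_pos[OF assms(2)] by (simp add: field_simps)
  then have "exp (real (lev R q) * ln (real (n q))) \<le> exp (ln (1 / R))" by simp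
  then have "real (n q) ^ lev R q \<le> 1 / R" using n_powr_eq[OF assms(2)] assms(1) by simp
  then show ?thesis using assms n_pos by (simp add: field_simps)
qed simp

lemma lev_side_ge':
  assumes "0 < R" "R \<le> 1" "q \<in> {1..d}"
  shows "R \<le> 1 / real (n q) ^ lev R q"
  using lev_side_ge[OF assms(1,3)] assms(2) by auto

lemma lev_side_le:
  assumes "R > 0" "q \<in> {1..d}"
  shows "1 / real (n q) ^ lev R q \<le> real (n d) * R"
proof -
  have "ln (1 / R) / ln (real (n q)) \<le> real (Suc (lev R q))" unfolding lev_def by linarith
  then have "ln (1 / R) \<le> real (Suc (lev R q)) * ln (real (n q))"
    using ln_n_pos[OF assms(2)] by (simp add: field_simps)
  then have "exp (ln (1 / R)) \<le> exp (real (Suc (lev R q)) * ln (real (n q)))" by simp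
  then have "1 / R \<le> real (n q) * real (n q) ^ lev R q"
    using n_powr_eq[OF assms(2), of "Suc (lev R q)"] assms(1) by simp
  then have "1 / real (n q) ^ lev R q \<le> real (n q) * R"
    using assms n_pos[OF assms(2)] by (simp add: field_simps)
  also have "\<dots> \<le> real (n d) * R" using n_le[OF assms(2)] assms(1) by simp
  finally show ?thesis .
qed

lemma ln_n_mono: "p \<in> {1..d} \<Longrightarrow> q \<in> {1..d} \<Longrightarrow> p \<le> q \<Longrightarrow> ln (real (n p)) \<le> ln (real (n q))"
  using n_pos[of p] n_pos[of q] strict_mono_onD[OF n_mono, of p q] by (cases "p = q") auto

lemma lev_antimono: "antimono_on {1..d} (lev R)"
proof (rule monotone_onI)
  fix p q assume pq: "p \<in> {1..d}" "q \<in> {1..d}" "p \<le> q"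
  show "lev R q \<le> lev R p"
  proof (cases "ln (1 / R) \<ge> 0")
    case True
    then have "ln (1 / R) / ln (real (n q)) \<le> ln (1 / R) / ln (real (n p))"
      using ln_n_mono[OF pq] ln_n_pos[OF pq(1)] ln_n_pos[OF pq(2)] by (intro divide_left_mono) auto
    then show ?thesis unfolding lev_def by (intro nat_mono floor_mono)
  next
    case False
    then have "ln (1 / R) / ln (real (n q)) < 0"
      using ln_n_pos[OF pq(2)] by (simp add: divide_neg_pos)
    then have "lev R q = 0" unfolding lev_def by simp
    then show ?thesis by simp
  qed
qed

text \<open>Points with equal codes at scale \<open>r\<close> differ by at most
  \<open>n d * r\<close> in each of \<open>d\<close> coordinates, hence by at most
  \<open>d * n d * r\<close>. This constant is the price of shrinking balls of that radius to radius
  \<open>r\<close>.\<close>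

definition cover_const :: real where
  "cover_const = real (covering_number (cball (0 :: (real, 'd) vec) (real d * real (n d))) 1)"

lemma covering_number_le_codes:
  assumes W: "W \<subseteq> words" and r: "r > 0"
  shows "real (covering_number (X ` W) r) \<le> cover_const * real (card (code (lev r) ` W))"
proof -
  let ?\<kappa> = "real d * real (n d)"
  have \<kappa>: "?\<kappa> > 0" using d n_pos[of d] by simp
  \<comment> \<open>One representative word is chosen for each code; the ball about its point covers
    all points sharing that code.\<close>
  let ?C = "(\<lambda>z. X (inv_into W (code (lev r)) z)) ` code (lev r) ` W"
  have "X ` W \<subseteq> (\<Union>x\<in>?C. cball x (?\<kappa> * r))"
  proof (rule image_subsetI)
    fix \<omega> assume w: "\<omega> \<in> W"
    let ?w = "inv_into W (code (lev r)) (code (lev r) \<omega>)"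
    have w': "?w \<in> W" "code (lev r) ?w = code (lev r) \<omega>"
      using w by (auto simp: inv_into_into f_inv_into_f)
    have "dist (X ?w) (X \<omega>) \<le> real d * (real (n d) * r)"
      using w w' W lev_side_le[OF r] by (intro dist_X_le[of _ _ "lev r"]) auto
    then have "X \<omega> \<in> cball (X ?w) (?\<kappa> * r)" by (simp add: mult.assoc)
    then show "X \<omega> \<in> (\<Union>x\<in>?C. cball x (?\<kappa> * r))" using w by blast
  qed
  then have "covering_number (X ` W) (?\<kappa> * r) \<le> card ?C"
    using finite_code[OF W] by (intro covering_number_le) auto
  also have "\<dots> \<le> card (code (lev r) ` W)" using finite_code[OF W] by (intro card_image_le)
  finally have *: "covering_number (X ` W) (?\<kappa> * r) \<le> card (code (lev r) ` W)" .
  have "real (covering_number (X ` W) r) \<le> cover_const * real (covering_number (X ` W) (?\<kappa> * r))"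
    using of_nat_mono[OF covering_number_doubling[OF bounded_X[OF W] r \<kappa>], where 'a=real]
    unfolding cover_const_def of_nat_mult by simp
  also have "\<dots> \<le> cover_const * real (card (code (lev r) ` W))"
    using * by (intro mult_left_mono) (auto simp: cover_const_def)
  finally show ?thesis .
qed

lemma cover_const_ge_1: "cover_const \<ge> 1"
proof -
  have "(0 :: (real, 'd) vec) \<in> cball 0 (real d * real (n d))"
    unfolding centre_in_cball by (intro mult_nonneg_nonneg) auto
  then have "covering_number (cball (0 :: (real, 'd) vec) (real d * real (n d))) 1 \<ge> 1"
    by (intro covering_number_ge_1 bounded_cball) (blast | simp)+
  then show ?thesis by (simp add: cover_const_def)
qed

lemma codes_le_covering_number:
  assumes W: "W \<subseteq> words" and r: "r > 0"
  shows "card (code (lev r) ` W) \<le> 4 ^ d * covering_number (X ` W) r"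
proof -
  obtain C where C: "finite C" "card C = covering_number (X ` W) r" "X ` W \<subseteq> (\<Union>x\<in>C. cball x r)"
    using covering_number_cover[OF bounded_X[OF W] r] by blast
  let ?V = "\<lambda>y. {\<omega> \<in> words. X \<omega> \<in> cball y r}"
  have "code (lev r) ` W \<subseteq> (\<Union>y\<in>C. code (lev r) ` ?V y)" using C(3) W by blast
  then have "card (code (lev r) ` W) \<le> card (\<Union>y\<in>C. code (lev r) ` ?V y)"
    using C(1) by (intro card_mono finite_UN_I finite_code) auto
  also have "\<dots> \<le> (\<Sum>y\<in>C. card (code (lev r) ` ?V y))" using C(1) by (rule card_UN_le)
  also have "\<dots> \<le> of_nat (card C) * 4 ^ d"
    by (intro sum_bounded_above card_code_ball lev_side_ge[OF r])
  finally show ?thesis using C(2) by (simp add: mult.commute)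
qed

text \<open>The ball meets at most \<open>4 ^ d\<close> cubes of its own size, and each contributes
  at most \<open>m\<close> smaller ones. The centre need not lie in the sponge, nor is
  \<open>R\<close> bounded.\<close>

lemma covering_number_ball_le:
  assumes R: "R > 0" and r: "r > 0"
    and m: "\<And>\<omega>. \<omega> \<in> words \<Longrightarrow> real (card (code (lev r) ` cylinder (lev R) \<omega>)) \<le> m"
  shows "real (covering_number (cball x R \<inter> F) r) \<le> cover_const * 4 ^ d * m"
proof -
  let ?W = "{\<omega> \<in> words. X \<omega> \<in> cball x R}"
  let ?Z = "code (lev R) ` ?W"
  have Z: "finite ?Z" by (rule finite_code) auto
  have "code (lev r) ` ?W \<subseteq> (\<Union>z\<in>?Z. code (lev r) ` {\<omega>' \<in> words. code (lev R) \<omega>' = z})" by blast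
  then have "card (code (lev r) ` ?W) \<le> card (\<Union>z\<in>?Z. code (lev r) ` {\<omega>' \<in> words. code (lev R) \<omega>' = z})"
    using Z by (intro card_mono finite_UN_I finite_code) auto
  also have "\<dots> \<le> (\<Sum>z\<in>?Z. card (code (lev r) ` {\<omega>' \<in> words. code (lev R) \<omega>' = z}))"
    using Z by (rule card_UN_le)
  finally have "real (card (code (lev r) ` ?W)) \<le> (\<Sum>z\<in>?Z. real (card (code (lev r) ` {\<omega>' \<in> words. code (lev R) \<omega>' = z})))"
    by (simp flip: of_nat_sum)
  also have "\<dots> \<le> of_nat (card ?Z) * m"
  proof (rule sum_bounded_above)
    fix z assume "z \<in> ?Z"
    then obtain \<omega> where w: "\<omega> \<in> words" "z = code (lev R) \<omega>" by blast
    show "real (card (code (lev r) ` {\<omega>' \<in> words. code (lev R) \<omega>' = z})) \<le> m"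
      using m[OF w(1)] unfolding w(2) cylinder_def .
  qed
  also have "\<dots> \<le> 4 ^ d * m"
  proof -
    obtain e where "e \<in> D" using D_nonempty by blast
    then have "(\<lambda>_. e) \<in> words" by (simp add: words_def)
    then have "m \<ge> 0" using m[of "\<lambda>_. e"] by (meson of_nat_0_le_iff order_trans)
    moreover have "card ?Z \<le> 4 ^ d" by (intro card_code_ball lev_side_ge[OF R])
    then have "real (card ?Z) \<le> 4 ^ d" using of_nat_mono[of "card ?Z" "4 ^ d", where 'a=real] by simp
    ultimately show ?thesis by (intro mult_right_mono) auto
  qed
  finally have "real (card (code (lev r) ` ?W)) \<le> 4 ^ d * m" .
  moreover have "real (covering_number (cball x R \<inter> F) r) \<le> cover_const * real (card (code (lev r) ` ?W))"
    unfolding cball_F by (rule covering_number_le_codes[OF _ r]) auto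
  moreover have "cover_const * real (card (code (lev r) ` ?W)) \<le> cover_const * (4 ^ d * m)"
    using calculation(1) cover_const_ge_1 by (intro mult_left_mono) auto
  ultimately show ?thesis by (simp add: mult.assoc)
qed

text \<open>The divisor \<open>d * n d\<close> is chosen so that the cube containing the centre has
  diameter at most \<open>R\<close> and hence lies inside the ball.\<close>

lemma covering_number_ball_ge:
  assumes R: "R > 0" and r: "r > 0" and w: "\<omega> \<in> words"
  shows "card (code (lev r) ` cylinder (lev (R / (real d * real (n d)))) \<omega>)
    \<le> 4 ^ d * covering_number (cball (X \<omega>) R \<inter> F) r"
proof -
  let ?\<kappa> = "real d * real (n d)"
  have \<kappa>: "?\<kappa> > 0" using d n_pos[of d] by simp
  have cancel: "k * (R / k) = R" if "k > 0" for k using that by simp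
  let ?W = "{\<omega>' \<in> words. X \<omega>' \<in> cball (X \<omega>) R}"
  have "cylinder (lev (R / ?\<kappa>)) \<omega> \<subseteq> ?W"
  proof
    fix \<omega>' assume "\<omega>' \<in> cylinder (lev (R / ?\<kappa>)) \<omega>"
    then have w': "\<omega>' \<in> words" "code (lev (R / ?\<kappa>)) \<omega>' = code (lev (R / ?\<kappa>)) \<omega>"
      by (auto simp: cylinder_def)
    have "dist (X \<omega>) (X \<omega>') \<le> real d * (real (n d) * (R / ?\<kappa>))"
      using w w' R \<kappa> lev_side_le[of "R / ?\<kappa>"] by (intro dist_X_le[of _ _ "lev (R / ?\<kappa>)"]) auto
    also have "\<dots> = ?\<kappa> * (R / ?\<kappa>)" by (simp only: mult.assoc)
    also have "\<dots> = R" using cancel[OF \<kappa>] .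
    finally show "\<omega>' \<in> ?W" using w' by simp
  qed
  then have "card (code (lev r) ` cylinder (lev (R / ?\<kappa>)) \<omega>) \<le> card (code (lev r) ` ?W)"
    by (intro card_mono finite_code image_mono) auto
  also have "\<dots> \<le> 4 ^ d * covering_number (cball (X \<omega>) R \<inter> F) r"
    unfolding cball_F by (rule codes_le_covering_number[OF _ r]) auto
  finally show ?thesis .
qed

text \<open>
  If every digit occurs right after the prefix defining an approximate cube, then in each
  coordinate the point is either well inside the cube, or that coordinate takes a single value
  on the whole sponge; so no neighbouring cube is near the point.
\<close>

lemma interior_cylinder:
  assumes R: "0 < R" "R \<le> 1" and w: "\<omega> \<in> words"
    and window: "\<And>q. q \<in> {1..d} \<Longrightarrow> D \<subseteq> \<omega> ` {lev R q..<lev R q + card D}"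
  shows "{\<omega>' \<in> words. X \<omega>' \<in> cball (X \<omega>) (R / (2 * real (n d) ^ card D))} \<subseteq> cylinder (lev R) \<omega>"
proof
  let ?c = "card D"
  fix \<omega>' assume "\<omega>' \<in> {\<omega>' \<in> words. X \<omega>' \<in> cball (X \<omega>) (R / (2 * real (n d) ^ card D))}"
  then have w': "\<omega>' \<in> words" and dst: "dist (X \<omega>) (X \<omega>') \<le> R / (2 * real (n d) ^ ?c)" by auto
  have "digit_code \<omega>' q (lev R q) = digit_code \<omega> q (lev R q)" if q: "q \<in> {1..d}" for q
  proof (cases "\<forall>e\<in>D. \<forall>e'\<in>D. e q = e' q")
    case True
    then have "\<omega>' k q = \<omega> k q" for k using w w' word_digit by blast
    then show ?thesis by simp
  next
    case False
    then obtain e e' where e: "e \<in> D" "e' \<in> D" "e q \<noteq> e' q" by blast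
    let ?a = "lev R q"
    obtain i j where "i \<in> {?a..<?a + ?c}" "j \<in> {?a..<?a + ?c}" and ij: "e = \<omega> i" "e' = \<omega> j"
      using window[OF q] e by blast
    then have ij': "i - ?a < ?c" "j - ?a < ?c" "?a + (i - ?a) = i" "?a + (j - ?a) = j" by auto
    define y where "y = base_code (n q) (\<lambda>k. \<omega> (?a + k) q) ?c"
    \<comment> \<open>Two letters differing in coordinate \<open>q\<close> occur in the window, so
      the digit block coded by \<open>y\<close> is not constant and \<open>y\<close> avoids both end
      values.\<close>
    have neq: "\<omega> (?a + (i - ?a)) q \<noteq> \<omega> (?a + (j - ?a)) q" using ij ij'(3,4) e(3) by simp
    have "1 \<le> y" "y + 2 \<le> n q ^ ?c"
      unfolding y_def using base_code_interior[of ?c "\<lambda>k. \<omega> (?a + k) q", OF _ ij'(1,2) neq]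
        digit_less[OF word_digit[OF w] q] by blast+
    then have y: "1 \<le> real y" "real y + 2 \<le> real (n q) ^ ?c"
      by (auto simp flip: of_nat_power)
    obtain c :: 'd where c: "coord_pos c = q" using coord_pos_surj[OF q] by blast
    let ?z = "digit_code \<omega> q ?a" and ?z' = "digit_code \<omega>' q ?a"
    let ?A = "real (n q) ^ ?a" and ?P = "real (n q) ^ ?c"
    have P: "?P > 0" "?A > 0" using n_pos[OF q] by auto
    have add: "real (digit_code \<omega> q (?a + ?c)) = ?P * real ?z + real y"
      by (simp add: base_code_add y_def)
    have "?P * real ?z + real y \<le> ?P * (?A * X \<omega> $ c)" "?P * (?A * X \<omega> $ c) \<le> ?P * real ?z + real y + 1"
      using sponge_point_bounds[OF w, of c "?a + ?c"] unfolding c add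
      by (simp_all add: power_add algebra_simps)
    then have "?P * real ?z + 1 \<le> ?P * (?A * X \<omega> $ c)" "?P * (?A * X \<omega> $ c) \<le> ?P * real ?z + ?P - 1"
      using y by linarith+
    then have mid: "real ?z + 1 / ?P \<le> ?A * X \<omega> $ c" "?A * X \<omega> $ c \<le> real ?z + 1 - 1 / ?P"
      using P by (simp_all add: field_simps)
    have "\<bar>X \<omega> $ c - X \<omega>' $ c\<bar> \<le> R / (2 * real (n d) ^ ?c)"
      using dist_vec_nth_le[of "X \<omega>" c "X \<omega>'"] dst by (simp add: dist_real_def)
    \<comment> \<open>The factor 2 in the radius makes this strict. With a margin of
      \<open>1 / ?P\<close> on both sides, the other point is then strictly inside the same cell, so
      the weak bounds force equal codes.\<close>
    also have "\<dots> < R / ?P"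
    proof -
      have "?P \<le> real (n d) ^ ?c" using n_le[OF q] by (intro power_mono) auto
      then have "?P < 2 * real (n d) ^ ?c" using P by linarith
      then show ?thesis using P(1) R by (intro divide_strict_left_mono mult_pos_pos) linarith+
    qed
    finally have "?A * \<bar>X \<omega> $ c - X \<omega>' $ c\<bar> < ?A * (R / ?P)"
      using P(2) by (rule mult_strict_left_mono)
    also have "\<dots> \<le> 1 / ?P"
    proof -
      have "?A * R \<le> 1" using lev_side_ge'[OF R q] P(2) by (simp add: pos_le_divide_eq mult.commute)
      then have "?A * R / ?P \<le> 1 / ?P" using P(1) by (intro divide_right_mono) auto
      then show ?thesis by simp
    qed
    finally have "\<bar>?A * X \<omega> $ c - ?A * X \<omega>' $ c\<bar> < 1 / ?P"
      using P by (simp add: abs_mult flip: right_diff_distrib)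
    then have "real ?z < ?A * X \<omega>' $ c" "?A * X \<omega>' $ c < real ?z + 1" using mid by linarith+
    then have "real ?z < real ?z' + 1" "real ?z' < real ?z + 1"
      using sponge_point_bounds[OF w', of c ?a] unfolding c by linarith+
    then show ?thesis by linarith
  qed
  then have "code (lev R) \<omega>' = code (lev R) \<omega>" unfolding code_def by (intro restrict_ext)
  then show "\<omega>' \<in> cylinder (lev R) \<omega>" using w' by (simp add: cylinder_def)
qed

lemma covering_number_interior_le:
  assumes R: "0 < R" "R \<le> 1" and r: "r > 0" and w: "\<omega> \<in> words"
    and window: "\<And>q. q \<in> {1..d} \<Longrightarrow> D \<subseteq> \<omega> ` {lev R q..<lev R q + card D}"
  shows "real (covering_number (cball (X \<omega>) (R / (2 * real (n d) ^ card D)) \<inter> F) r)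
    \<le> cover_const * real (card (code (lev r) ` cylinder (lev R) \<omega>))"
proof -
  let ?W = "{\<omega>' \<in> words. X \<omega>' \<in> cball (X \<omega>) (R / (2 * real (n d) ^ card D))}"
  have "card (code (lev r) ` ?W) \<le> card (code (lev r) ` cylinder (lev R) \<omega>)"
    using interior_cylinder[OF R w window]
    by (intro card_mono finite_code image_mono) (auto simp: cylinder_def)
  then have "cover_const * real (card (code (lev r) ` ?W)) \<le> cover_const * real (card (code (lev r) ` cylinder (lev R) \<omega>))"
    using cover_const_ge_1 by (intro mult_left_mono) auto
  moreover have "real (covering_number (X ` ?W) r) \<le> cover_const * real (card (code (lev r) ` ?W))"
    by (rule covering_number_le_codes[OF _ r]) auto
  ultimately show ?thesis unfolding cball_F by linarith
qed

end

section \<open>Extremal numbers of subcubes\<close>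

lemma ext_max_0: "D \<noteq> {} \<Longrightarrow> ext_max D 0 t = card (digit_proj t D)"
  by (simp add: ext_max_def ext_count_0 image_constant_conv)

lemma ext_min_0: "D \<noteq> {} \<Longrightarrow> ext_min D 0 t = card (digit_proj t D)"
  by (simp add: ext_min_def ext_count_0 image_constant_conv)

lemma window_residue:
  fixes a c j :: nat
  assumes "j < c"
  shows "\<exists>k\<in>{a..<a + c}. k mod c = j"
proof (induction a)
  case 0
  then show ?case using assms by (intro bexI[of _ j]) auto
next
  case (Suc a)
  then obtain k where k: "a \<le> k" "k < a + c" "k mod c = j" by auto
  show ?case
  proof (cases "k = a")
    case True
    then show ?thesis using k assms by (intro bexI[of _ "a + c"]) auto
  next
    case False
    then show ?thesis using k by (intro bexI[of _ k]) auto
  qed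
qed

context digit_system
begin

lemma ext_max_ge_1: "ext_max D s t \<ge> 1"
  using ext_attained(1)[OF finite_D D_nonempty, of s t] ext_count_ge_1[OF finite_D] by metis

lemma ext_min_ge_1: "ext_min D s t \<ge> 1"
  using ext_attained(2)[OF finite_D D_nonempty, of s t] ext_count_ge_1[OF finite_D] by metis

lemma ext_max_diag: "ext_max D s s = 1"
  using ext_attained(1)[OF finite_D D_nonempty, of s s] ext_count_eq_1 by (metis order_refl)

lemma ext_min_diag: "ext_min D s s = 1"
  using ext_attained(2)[OF finite_D D_nonempty, of s s] ext_count_eq_1 by (metis order_refl)

lemma digit_proj_full: "digit_proj d D = D"
proof -
  have "restrict e {1..d} = e" if "e \<in> D" for e
    using that D by (intro extensional_restrict) (auto simp: digit_tuples_def PiE_iff)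
  then show ?thesis by (simp add: digit_proj_def)
qed

end

context sponge_system
begin

text \<open>Logarithm of the product of extremal factors, with \<open>G\<close> standing for
  \<open>ext_max D\<close> or \<open>ext_min D\<close>. The summation range bounds the depths at
  both scales without presupposing which scale is smaller.\<close>

definition level_log :: "(nat \<Rightarrow> nat \<Rightarrow> nat) \<Rightarrow> real \<Rightarrow> real \<Rightarrow> real" where
  "level_log G R r = (\<Sum>k<lev R 1 + lev r 1. ln (real (G (active d (lev R) k) (active d (lev r) k))))"

lemma lev_le_1: "q \<in> {1..d} \<Longrightarrow> lev R q \<le> lev R 1"
  using monotone_onD[OF lev_antimono, of 1 q R] by auto

lemma card_codes_eq:
  assumes "\<omega> \<in> words"
  shows "card (code (lev r) ` cylinder (lev R) \<omega>) =
    (\<Prod>k<lev R 1 + lev r 1. ext_count D (active d (lev R) k) (active d (lev r) k) (\<omega> k))"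
proof (rule card_code_cylinder[OF assms lev_antimono _ lev_antimono])
  fix q assume q: "q \<in> {1..d}"
  show "lev R q \<le> lev R 1 + lev r 1" using lev_le_1[OF q, of R] by simp
  show "lev r q \<le> lev R 1 + lev r 1" using lev_le_1[OF q, of r] by simp
qed

lemma exp_level_log:
  assumes "\<And>s t. G s t \<ge> 1"
  shows "exp (level_log G R r) = (\<Prod>k<lev R 1 + lev r 1. real (G (active d (lev R) k) (active d (lev r) k)))"
proof -
  have "real (G s t) > 0" for s t using assms[of s t] by linarith
  then show ?thesis by (simp add: level_log_def exp_sum)
qed

lemma card_codes_le:
  assumes "\<omega> \<in> words"
  shows "real (card (code (lev r) ` cylinder (lev R) \<omega>)) \<le> exp (level_log (ext_max D) R r)"
  unfolding card_codes_eq[OF assms] exp_level_log[OF ext_max_ge_1] of_nat_prod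
  using ext_bounds(2)[OF finite_D] word_digit[OF assms] by (intro prod_mono) auto

lemma card_codes_ge:
  assumes "\<omega> \<in> words"
  shows "exp (level_log (ext_min D) R r) \<le> real (card (code (lev r) ` cylinder (lev R) \<omega>))"
  unfolding card_codes_eq[OF assms] exp_level_log[OF ext_min_ge_1] of_nat_prod
  using ext_bounds(1)[OF finite_D] word_digit[OF assms] by (intro prod_mono) auto

text \<open>Positions are independent, so an extremal letter can be chosen at each of them and the
  bound for the whole product is reached.\<close>

lemma card_codes_max_attained:
  "\<exists>\<omega>\<in>words. real (card (code (lev r) ` cylinder (lev R) \<omega>)) = exp (level_log (ext_max D) R r)"
proof -
  have "\<forall>k. \<exists>e. e \<in> D \<and> ext_count D (active d (lev R) k) (active d (lev r) k) e
      = ext_max D (active d (lev R) k) (active d (lev r) k)"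
    using ext_attained(1)[OF finite_D D_nonempty] by blast
  from choice[OF this] obtain \<omega> where \<omega>: "\<forall>k. \<omega> k \<in> D \<and> ext_count D (active d (lev R) k) (active d (lev r) k) (\<omega> k)
      = ext_max D (active d (lev R) k) (active d (lev r) k)" by blast
  then have w: "\<omega> \<in> words" by (simp add: words_def)
  show ?thesis
    by (rule bexI[OF _ w]) (simp add: card_codes_eq[OF w] exp_level_log[OF ext_max_ge_1] \<omega>)
qed

text \<open>
  Enumerating \<open>D\<close> periodically in all windows costs at most \<open>d * card D\<close> positions, however
  much the windows overlap.
\<close>

lemma card_codes_min_interior:
  "\<exists>\<omega>\<in>words. (\<forall>q\<in>{1..d}. D \<subseteq> \<omega> ` {lev R q..<lev R q + card D}) \<and>
     real (card (code (lev r) ` cylinder (lev R) \<omega>)) \<le>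
       real (card D) ^ (d * card D) * exp (level_log (ext_min D) R r)"
proof -
  let ?c = "card D"
  let ?M = "lev R 1 + lev r 1"
  let ?s = "active d (lev R)" and ?t = "active d (lev r)"
  have c: "?c \<ge> 1" using D_nonempty finite_D by (simp add: Suc_le_eq card_gt_0_iff)
  obtain v where v: "bij_betw v {0..<?c} D" using ex_bij_betw_nat_finite[OF finite_D] by blast
  have "\<forall>k. \<exists>e. e \<in> D \<and> ext_count D (?s k) (?t k) e = ext_min D (?s k) (?t k)"
    using ext_attained(2)[OF finite_D D_nonempty] by blast
  from choice[OF this] obtain m where m: "\<forall>k. m k \<in> D \<and> ext_count D (?s k) (?t k) (m k) = ext_min D (?s k) (?t k)"
    by blast
  define bad where "bad = (\<Union>q\<in>{1..d}. {lev R q..<lev R q + ?c})"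
  \<comment> \<open>The letter depends on \<open>k\<close> alone and not on the window, so
    overlapping windows never conflict, and any \<open>card D\<close> consecutive positions show all
    of \<open>D\<close>.\<close>
  define \<omega> where "\<omega> k = (if k \<in> bad then v (k mod ?c) else m k)" for k
  have "v (k mod ?c) \<in> D" for k using bij_betwE[OF v] c by auto
  then have w: "\<omega> \<in> words" using m by (simp add: words_def \<omega>_def)
  have window: "D \<subseteq> \<omega> ` {lev R q..<lev R q + ?c}" if q: "q \<in> {1..d}" for q
  proof
    fix e assume "e \<in> D"
    then have "e \<in> v ` {0..<?c}" using v by (simp add: bij_betw_def)
    then obtain j where j: "j < ?c" "e = v j" by auto
    obtain k where k: "k \<in> {lev R q..<lev R q + ?c}" "k mod ?c = j" using window_residue[OF j(1)] by blast
    then have "k \<in> bad" using q by (auto simp: bad_def)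
    then have "\<omega> k = e" using k j by (simp add: \<omega>_def)
    then show "e \<in> \<omega> ` {lev R q..<lev R q + ?c}" using k(1) by blast
  qed
  have "card bad \<le> (\<Sum>q\<in>{1..d}. card {lev R q..<lev R q + ?c})"
    unfolding bad_def by (rule card_UN_le) auto
  then have bad: "card bad \<le> d * ?c" by simp
  have "finite bad" by (simp add: bad_def)
  \<comment> \<open>At a wasted position the factor is at most \<open>card D\<close>, while the
    minimum it replaces is at least 1.\<close>
  have "ext_count D (?s k) (?t k) (\<omega> k) \<le> (if k \<in> bad then ?c else 1) * ext_min D (?s k) (?t k)" for k
  proof (cases "k \<in> bad")
    case True
    have "ext_count D (?s k) (?t k) (\<omega> k) \<le> ?c * 1" using ext_count_le_card[OF finite_D] by simp
    also have "\<dots> \<le> ?c * ext_min D (?s k) (?t k)" using ext_min_ge_1 by (intro mult_left_mono) auto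
    finally show ?thesis using True by simp
  qed (simp add: \<omega>_def m)
  then have "(\<Prod>k<?M. ext_count D (?s k) (?t k) (\<omega> k)) \<le> (\<Prod>k<?M. (if k \<in> bad then ?c else 1) * ext_min D (?s k) (?t k))"
    by (intro prod_mono) auto
  also have "\<dots> = ?c ^ card ({..<?M} \<inter> bad) * (\<Prod>k<?M. ext_min D (?s k) (?t k))"
    by (simp add: prod.distrib prod.If_cases Int_def)
  also have "\<dots> \<le> ?c ^ (d * ?c) * (\<Prod>k<?M. ext_min D (?s k) (?t k))"
  proof -
    have "card ({..<?M} \<inter> bad) \<le> card bad" using \<open>finite bad\<close> by (intro card_mono) auto
    then show ?thesis using bad c by (intro mult_right_mono power_increasing) auto
  qed
  finally have "card (code (lev r) ` cylinder (lev R) \<omega>) \<le> ?c ^ (d * ?c) * (\<Prod>k<?M. ext_min D (?s k) (?t k))"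
    by (simp add: card_codes_eq[OF w])
  from of_nat_mono[OF this, where 'a=real]
  have "real (card (code (lev r) ` cylinder (lev R) \<omega>)) \<le> real ?c ^ (d * ?c) * exp (level_log (ext_min D) R r)"
    by (simp add: exp_level_log[OF ext_min_ge_1])
  then show ?thesis using w window by blast
qed


section \<open>Asymptotics of the extremal numbers\<close>

lemma lev_approx:
  assumes "0 < R" "R \<le> 1" "q \<in> {1..d}"
  shows "\<bar>real (lev R q) - ln (1 / R) / ln (real (n q))\<bar> \<le> 1"
proof -
  have "ln (1 / R) / ln (real (n q)) \<ge> 0" using assms ln_n_pos[OF assms(3)] by simp
  then show ?thesis unfolding lev_def by linarith
qed

lemma lev_sum_approx:
  assumes "0 < R" "R \<le> 1"
  shows "\<bar>(\<Sum>q=1..d. c q * real (lev R q)) - ln (1 / R) * (\<Sum>q=1..d. c q / ln (real (n q)))\<bar> \<le> (\<Sum>q=1..d. \<bar>c q\<bar>)"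
proof -
  have "(\<Sum>q=1..d. c q * real (lev R q)) - ln (1 / R) * (\<Sum>q=1..d. c q / ln (real (n q)))
     = (\<Sum>q=1..d. c q * (real (lev R q) - ln (1 / R) / ln (real (n q))))"
    by (simp add: sum_distrib_left sum_subtractf right_diff_distrib mult.commute)
  also have "\<bar>\<dots>\<bar> \<le> (\<Sum>q=1..d. \<bar>c q * (real (lev R q) - ln (1 / R) / ln (real (n q)))\<bar>)" by (rule sum_abs)
  also have "\<dots> \<le> (\<Sum>q=1..d. \<bar>c q\<bar>)"
  proof (rule sum_mono)
    fix q assume "q \<in> {1..d}"
    from mult_left_mono[OF lev_approx[OF assms this], of "\<bar>c q\<bar>"]
    show "\<bar>c q * (real (lev R q) - ln (1 / R) / ln (real (n q)))\<bar> \<le> \<bar>c q\<bar>" by (simp add: abs_mult)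
  qed
  finally show ?thesis .
qed

lemma lev_mono:
  assumes "0 < r" "r \<le> R" "q \<in> {1..d}"
  shows "lev R q \<le> lev r q"
proof -
  have "ln (1 / R) \<le> ln (1 / r)" using assms by (simp add: frac_le)
  then have "ln (1 / R) / ln (real (n q)) \<le> ln (1 / r) / ln (real (n q))"
    using ln_n_pos[OF assms(3)] by (intro divide_right_mono) auto
  then show ?thesis unfolding lev_def by (intro nat_mono floor_mono)
qed

lemma lev_diff_le:
  assumes "0 < r" "r \<le> R" "q \<in> {1..d}"
  shows "real (lev r q) - real (lev R q) \<le> ln (R / r) / ln (real (n q)) + 1"
proof -
  have "ln (1 / r) = ln (1 / R) + ln (R / r)" using assms by (simp add: ln_div)
  then have eq: "ln (1 / r) / ln (real (n q)) = ln (1 / R) / ln (real (n q)) + ln (R / r) / ln (real (n q))"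
    by (simp add: add_divide_distrib)
  have "ln (R / r) / ln (real (n q)) \<ge> 0" using assms ln_n_pos[OF assms(3)] by simp
  then show ?thesis using eq unfolding lev_def by linarith
qed

text \<open>\<open>R \<le> 1\<close> is used here: above 1 the depth is truncated to 0, which can
  make the difference too small. The upper estimate tolerates this truncation, matching the ranges
  of \<open>R\<close> in the two dimensions.\<close>

lemma lev_diff_ge:
  assumes "0 < r" "r \<le> R" "R \<le> 1" "q \<in> {1..d}"
  shows "ln (R / r) / ln (real (n q)) - 1 \<le> real (lev r q) - real (lev R q)"
proof -
  have "ln (1 / r) = ln (1 / R) + ln (R / r)" using assms by (simp add: ln_div)
  then have eq: "ln (1 / r) / ln (real (n q)) = ln (1 / R) / ln (real (n q)) + ln (R / r) / ln (real (n q))"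
    by (simp add: add_divide_distrib)
  have "ln (1 / R) / ln (real (n q)) \<ge> 0" using assms ln_n_pos[OF assms(4)] by simp
  then show ?thesis using eq unfolding lev_def by linarith
qed

text \<open>The classical box dimension formula for sponges; the projection to 0 coordinates is a
  single tuple.\<close>

definition box_value :: real where
  "box_value = (\<Sum>q=1..d. (ln (real (card (digit_proj q D))) - ln (real (card (digit_proj (q - 1) D)))) / ln (real (n q)))"

text \<open>The bracket multiplied by \<theta> in the explicit formulae, with the conventions N_0 =
  |D| and N_d = 1 making all its terms uniform.\<close>

definition fibre_value :: "(nat \<Rightarrow> nat \<Rightarrow> nat) \<Rightarrow> real" where
  "fibre_value G = (\<Sum>q=1..d. (ln (real (G (q - 1) d)) - ln (real (G q d))) / ln (real (n q)))"

text \<open>Only one-step extensions enter. This becomes the common value of spectrum and dimension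
  for large \<theta>.\<close>

definition local_value :: "(nat \<Rightarrow> nat \<Rightarrow> nat) \<Rightarrow> real" where
  "local_value G = (\<Sum>q=1..d. ln (real (G (q - 1) q)) / ln (real (n q)))"

lemma level_log_separated:
  assumes G: "\<And>t. G 0 t = card (digit_proj t D)" and le: "lev R 1 \<le> lev r d"
  shows "level_log G R r = (\<Sum>q=1..d. (ln (real (G q d)) - ln (real (G (q - 1) d))) * real (lev R q))
     + (\<Sum>q=1..d. (ln (real (card (digit_proj q D))) - ln (real (card (digit_proj (q - 1) D)))) * real (lev r q))"
proof -
  let ?M = "lev R 1 + lev r 1"
  \<comment> \<open>The identity separates the two scales. It holds for \<open>s = 0\<close> since
    \<open>G 0 t\<close> counts projections, and for \<open>t = d\<close> since the last two terms
    cancel; the depth condition leaves no other case.\<close>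
  have split: "ln (real (G (active d (lev R) k) (active d (lev r) k))) =
     ln (real (G (active d (lev R) k) d)) + ln (real (card (digit_proj (active d (lev r) k) D))) - ln (real (G 0 d))" for k
  proof (cases "active d (lev R) k = 0")
    case True
    then show ?thesis by (simp add: G)
  next
    case False
    then have "1 \<le> active d (lev R) k" by simp
    then have "k < lev R 1" using active_iff[OF lev_antimono, of 1 R k] d by simp
    then have "d \<le> active d (lev r) k" using active_iff[OF lev_antimono, of d r k] d le by simp
    then have "active d (lev r) k = d" using active_le[of d "lev r" k] by simp
    then show ?thesis by (simp add: G)
  qed
  \<comment> \<open>The terms \<open>?M * ln (real (G 0 d))\<close> cancel, and the remaining
    boundary term vanishes because this cardinality is 1.\<close>
  have "digit_proj 0 D = {\<lambda>_. undefined}"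
    unfolding digit_proj_def using D_nonempty by (auto simp: restrict_def)
  then have one: "card (digit_proj 0 D) = 1" by simp
  have M: "q \<in> {1..d} \<Longrightarrow> lev R q \<le> ?M" "q \<in> {1..d} \<Longrightarrow> lev r q \<le> ?M" for q
    using lev_le_1[of q R] lev_le_1[of q r] by auto
  have "level_log G R r = (\<Sum>k<?M. ln (real (G (active d (lev R) k) d)))
      + (\<Sum>k<?M. ln (real (card (digit_proj (active d (lev r) k) D)))) - ?M * ln (real (G 0 d))"
    unfolding level_log_def split by (simp add: sum.distrib sum_subtractf)
  moreover have "(\<Sum>k<?M. ln (real (G (active d (lev R) k) d))) = ?M * ln (real (G 0 d))
      + (\<Sum>q=1..d. (ln (real (G q d)) - ln (real (G (q - 1) d))) * real (lev R q))"
    by (rule sum_of_active[OF lev_antimono M(1)])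
  moreover have "(\<Sum>k<?M. ln (real (card (digit_proj (active d (lev r) k) D)))) = ?M * ln (real (card (digit_proj 0 D)))
      + (\<Sum>q=1..d. (ln (real (card (digit_proj q D))) - ln (real (card (digit_proj (q - 1) D)))) * real (lev r q))"
    by (rule sum_of_active[OF lev_antimono M(2)])
  ultimately show ?thesis unfolding one by simp
qed

lemma level_log_separated_approx:
  assumes G: "\<And>t. G 0 t = card (digit_proj t D)"
  shows "\<exists>K\<ge>0. \<forall>R r. 0 < R \<and> R \<le> 1 \<and> 0 < r \<and> r \<le> 1 \<and> lev R 1 \<le> lev r d \<longrightarrow>
    \<bar>level_log G R r - (box_value * ln (1 / r) - fibre_value G * ln (1 / R))\<bar> \<le> K"
proof -
  let ?c = "\<lambda>q. ln (real (G q d)) - ln (real (G (q - 1) d))"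
  let ?e = "\<lambda>q. ln (real (card (digit_proj q D))) - ln (real (card (digit_proj (q - 1) D)))"
  have f: "fibre_value G = - (\<Sum>q=1..d. ?c q / ln (real (n q)))"
    unfolding fibre_value_def sum_negf[symmetric] by (simp add: minus_divide_left)
  have "\<bar>level_log G R r - (box_value * ln (1 / r) - fibre_value G * ln (1 / R))\<bar>
      \<le> (\<Sum>q=1..d. \<bar>?c q\<bar>) + (\<Sum>q=1..d. \<bar>?e q\<bar>)"
    if "0 < R" "R \<le> 1" "0 < r" "r \<le> 1" "lev R 1 \<le> lev r d" for R r
  proof -
    have 1: "\<bar>(\<Sum>q=1..d. ?c q * real (lev R q)) - ln (1 / R) * (- fibre_value G)\<bar> \<le> (\<Sum>q=1..d. \<bar>?c q\<bar>)"
      using lev_sum_approx[OF that(1,2), of ?c] unfolding f by simp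
    have 2: "\<bar>(\<Sum>q=1..d. ?e q * real (lev r q)) - ln (1 / r) * box_value\<bar> \<le> (\<Sum>q=1..d. \<bar>?e q\<bar>)"
      using lev_sum_approx[OF that(3,4), of ?e] unfolding box_value_def .
    have "ln (1 / R) * (- fibre_value G) = - (fibre_value G * ln (1 / R))"
      "ln (1 / r) * box_value = box_value * ln (1 / r)" by simp_all
    then show ?thesis using 1 2 unfolding level_log_separated[where G=G, OF G that(5)] by linarith
  qed
  then show ?thesis
    by (intro exI[of _ "(\<Sum>q=1..d. \<bar>?c q\<bar>) + (\<Sum>q=1..d. \<bar>?e q\<bar>)"]) (auto intro!: add_nonneg_nonneg sum_nonneg)
qed

lemma sum_lev_between:
  assumes "0 < r" "r \<le> R"
  shows "(\<Sum>k<lev R 1 + lev r 1. \<Sum>q=Suc (active d (lev R) k)..active d (lev r) k. h q)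
    = (\<Sum>q=1..d. h q * (real (lev r q) - real (lev R q)))"
proof (rule sum_between_active[OF lev_antimono lev_antimono])
  fix q assume q: "q \<in> {1..d}"
  show "lev R q \<le> lev r q" using lev_mono[OF assms q] .
  show "lev r q \<le> lev R 1 + lev r 1" using lev_le_1[OF q, of r] by simp
qed

lemma active_lev_mono:
  assumes "0 < r" "r \<le> R"
  shows "active d (lev R) k \<le> active d (lev r) k"
  unfolding active_def using lev_mono[OF assms] by (intro card_mono) (auto intro: less_le_trans)

text \<open>If the finer scale sees coordinate \<open>p + 1\<close> at some position, the depth
  condition says that the coarser one fixes coordinate \<open>p\<close> there. Each position thus
  adds at most one coordinate, and every factor is 1 or a one-step number.\<close>

lemma level_log_interlaced:
  assumes G: "\<And>s. G s s = 1" and r: "0 < r" "r \<le> R"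
    and le: "\<And>p. 1 \<le> p \<Longrightarrow> Suc p \<le> d \<Longrightarrow> lev r (Suc p) \<le> lev R p"
  shows "level_log G R r = (\<Sum>q=1..d. ln (real (G (q - 1) q)) * (real (lev r q) - real (lev R q)))"
proof -
  have "ln (real (G (active d (lev R) k) (active d (lev r) k))) =
     (\<Sum>q=Suc (active d (lev R) k)..active d (lev r) k. ln (real (G (q - 1) q)))" for k
  proof -
    let ?s = "active d (lev R) k" and ?t = "active d (lev r) k"
    have "?s \<le> ?t" by (rule active_lev_mono[OF r])
    moreover have "?t \<le> Suc ?s"
    proof (cases "?t \<le> 1")
      case False
      then obtain p where p: "?t = Suc p" "1 \<le> p" by (cases ?t) auto
      have "Suc p \<le> d" using active_le[of d "lev r" k] p by simp
      then have "k < lev r (Suc p)" using active_iff[OF lev_antimono, of "Suc p" r k] p by simp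
      then have "k < lev R p" using le[OF p(2) \<open>Suc p \<le> d\<close>] by simp
      then show ?thesis using active_iff[OF lev_antimono, of p R k] p \<open>Suc p \<le> d\<close> by simp
    qed simp
    ultimately consider "?t = ?s" | "?t = Suc ?s" by linarith
    then show ?thesis by cases (simp_all add: G)
  qed
  then show ?thesis unfolding level_log_def using sum_lev_between[OF r] by simp
qed

text \<open>One-step maxima dominate whatever the relation between the two scales; rounding costs at
  most one digit per coordinate, whence the additive constant.\<close>

lemma level_log_max_le:
  assumes r: "0 < r" "r \<le> R"
  shows "level_log (ext_max D) R r \<le> local_value (ext_max D) * ln (R / r) + (\<Sum>q=1..d. ln (real (ext_max D (q - 1) q)))"
proof -
  have pos: "real (ext_max D s t) \<ge> 1" for s t using ext_max_ge_1[of s t] by linarith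
  have "level_log (ext_max D) R r \<le>
      (\<Sum>k<lev R 1 + lev r 1. \<Sum>q=Suc (active d (lev R) k)..active d (lev r) k. ln (real (ext_max D (q - 1) q)))"
    unfolding level_log_def
  proof (rule sum_mono)
    fix k
    let ?s = "active d (lev R) k" and ?t = "active d (lev r) k"
    obtain e where e: "e \<in> D" "ext_count D ?s ?t e = ext_max D ?s ?t"
      using ext_attained(1)[OF finite_D D_nonempty] by blast
    have "ext_max D ?s ?t \<le> (\<Prod>q=Suc ?s..?t. ext_max D (q - 1) q)"
      using ext_count_le_prod(1)[OF finite_D e(1) active_lev_mono[OF r], of k] e(2) by simp
    from of_nat_mono[OF this, where 'a=real]
    have "real (ext_max D ?s ?t) \<le> (\<Prod>q=Suc ?s..?t. real (ext_max D (q - 1) q))" by simp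
    then have "ln (real (ext_max D ?s ?t)) \<le> ln (\<Prod>q=Suc ?s..?t. real (ext_max D (q - 1) q))"
      using pos[of ?s ?t] by (intro ln_mono) auto
    also have "\<dots> = (\<Sum>q=Suc ?s..?t. ln (real (ext_max D (q - 1) q)))"
      using ext_max_ge_1 by (intro ln_prod) (auto simp: Suc_le_eq)
    finally show "ln (real (ext_max D ?s ?t)) \<le> (\<Sum>q=Suc ?s..?t. ln (real (ext_max D (q - 1) q)))" .
  qed
  also have "\<dots> = (\<Sum>q=1..d. ln (real (ext_max D (q - 1) q)) * (real (lev r q) - real (lev R q)))"
    by (rule sum_lev_between[OF r])
  also have "\<dots> \<le> (\<Sum>q=1..d. ln (real (ext_max D (q - 1) q)) * (ln (R / r) / ln (real (n q)) + 1))"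
    using lev_diff_le[OF r] pos by (intro sum_mono mult_left_mono) auto
  also have "\<dots> = local_value (ext_max D) * ln (R / r) + (\<Sum>q=1..d. ln (real (ext_max D (q - 1) q)))"
    by (simp add: local_value_def distrib_left sum.distrib sum_distrib_right)
  finally show ?thesis .
qed

lemma level_log_min_ge:
  assumes r: "0 < r" "r \<le> R" "R \<le> 1"
  shows "local_value (ext_min D) * ln (R / r) - (\<Sum>q=1..d. ln (real (ext_min D (q - 1) q))) \<le> level_log (ext_min D) R r"
proof -
  have pos: "real (ext_min D s t) \<ge> 1" for s t using ext_min_ge_1[of s t] by linarith
  have "local_value (ext_min D) * ln (R / r) - (\<Sum>q=1..d. ln (real (ext_min D (q - 1) q)))
      = (\<Sum>q=1..d. ln (real (ext_min D (q - 1) q)) * (ln (R / r) / ln (real (n q)) - 1))"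
    by (simp add: local_value_def right_diff_distrib sum_subtractf sum_distrib_right)
  also have "\<dots> \<le> (\<Sum>q=1..d. ln (real (ext_min D (q - 1) q)) * (real (lev r q) - real (lev R q)))"
    using lev_diff_ge[OF r] pos by (intro sum_mono mult_left_mono) auto
  also have "\<dots> = (\<Sum>k<lev R 1 + lev r 1. \<Sum>q=Suc (active d (lev R) k)..active d (lev r) k. ln (real (ext_min D (q - 1) q)))"
    by (rule sum_lev_between[OF r(1,2), symmetric])
  also have "\<dots> \<le> level_log (ext_min D) R r"
    unfolding level_log_def
  proof (rule sum_mono)
    fix k
    let ?s = "active d (lev R) k" and ?t = "active d (lev r) k"
    obtain e where e: "e \<in> D" "ext_count D ?s ?t e = ext_min D ?s ?t"
      using ext_attained(2)[OF finite_D D_nonempty] by blast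
    have "(\<Prod>q=Suc ?s..?t. ext_min D (q - 1) q) \<le> ext_min D ?s ?t"
      using ext_count_le_prod(2)[OF finite_D e(1) active_lev_mono[OF r(1,2)], of k] e(2) by simp
    from of_nat_mono[OF this, where 'a=real]
    have le: "(\<Prod>q=Suc ?s..?t. real (ext_min D (q - 1) q)) \<le> real (ext_min D ?s ?t)" by simp
    have "(\<Sum>q=Suc ?s..?t. ln (real (ext_min D (q - 1) q))) = ln (\<Prod>q=Suc ?s..?t. real (ext_min D (q - 1) q))"
      using ext_min_ge_1 by (intro ln_prod[symmetric]) (auto simp: Suc_le_eq)
    also have "\<dots> \<le> ln (real (ext_min D ?s ?t))"
      using le ext_min_ge_1 by (intro ln_mono prod_pos) (auto simp: Suc_le_eq)
    finally show "(\<Sum>q=Suc ?s..?t. ln (real (ext_min D (q - 1) q))) \<le> ln (real (ext_min D ?s ?t))" .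
  qed
  finally show ?thesis .
qed

lemma level_log_interlaced_approx:
  assumes G: "\<And>s. G s s = 1" "\<And>s t. G s t \<ge> 1" and r: "0 < r" "r \<le> R" "R \<le> 1"
    and le: "\<And>p. 1 \<le> p \<Longrightarrow> Suc p \<le> d \<Longrightarrow> lev r (Suc p) \<le> lev R p"
  shows "\<bar>level_log G R r - local_value G * ln (R / r)\<bar> \<le> (\<Sum>q=1..d. ln (real (G (q - 1) q)))"
proof -
  let ?g = "\<lambda>q. ln (real (G (q - 1) q))"
  have pos: "?g q \<ge> 0" for q using G(2)[of "q - 1" q] by simp
  have eq: "level_log G R r = (\<Sum>q=1..d. ?g q * (real (lev r q) - real (lev R q)))"
    by (rule level_log_interlaced[where G=G, OF G(1) r(1,2) le])
  have val: "local_value G * ln (R / r) = (\<Sum>q=1..d. ?g q * (ln (R / r) / ln (real (n q))))"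
    by (simp add: local_value_def sum_distrib_right)
  have "level_log G R r - local_value G * ln (R / r)
      = (\<Sum>q=1..d. ?g q * ((real (lev r q) - real (lev R q)) - ln (R / r) / ln (real (n q))))"
    unfolding eq val sum_subtractf[symmetric] right_diff_distrib[symmetric] ..
  then have "\<bar>level_log G R r - local_value G * ln (R / r)\<bar>
      = \<bar>\<Sum>q=1..d. ?g q * ((real (lev r q) - real (lev R q)) - ln (R / r) / ln (real (n q)))\<bar>" by (rule arg_cong)
  also have "\<dots> \<le> (\<Sum>q=1..d. \<bar>?g q * ((real (lev r q) - real (lev R q)) - ln (R / r) / ln (real (n q)))\<bar>)"
    by (rule sum_abs)
  also have "\<dots> \<le> (\<Sum>q=1..d. ?g q)"
  proof (rule sum_mono)
    fix q assume q: "q \<in> {1..d}"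
    have "\<bar>(real (lev r q) - real (lev R q)) - ln (R / r) / ln (real (n q))\<bar> \<le> 1"
      using lev_diff_le[OF r(1,2) q] lev_diff_ge[OF r q] by linarith
    from mult_left_mono[OF this pos[of q]]
    show "\<bar>?g q * ((real (lev r q) - real (lev R q)) - ln (R / r) / ln (real (n q)))\<bar> \<le> ?g q"
      using pos[of q] by (simp add: abs_mult)
  qed
  finally show ?thesis .
qed

end

section \<open>Spectra and dimensions of the sponge\<close>

lemma exp_approx:
  fixes t K x y :: real
  assumes "\<bar>x - t * ln y\<bar> \<le> K" "y > 0"
  shows "exp x \<le> exp K * y powr t" "exp (- K) * y powr t \<le> exp x"
  using assms by (auto simp: powr_def simp flip: exp_add)

lemma ln_scale_quotient:
  fixes R \<theta> :: real
  assumes "0 < R" "\<theta> > 0"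
  shows "ln (R / R powr (1 / \<theta>)) = (1 / \<theta> - 1) * ln (1 / R)" "ln (1 / R powr (1 / \<theta>)) = ln (1 / R) / \<theta>"
  using assms by (simp_all add: ln_div ln_powr algebra_simps)

definition rescale_const :: "'a::euclidean_space itself \<Rightarrow> real \<Rightarrow> real \<Rightarrow> real" where
  "rescale_const A \<kappa> \<theta> = real (covering_number (cball (0 :: 'a) (\<kappa> powr (1 / \<theta>))) 1)"

lemma rescale_const_ge_1: "rescale_const TYPE('a::euclidean_space) \<kappa> \<theta> \<ge> 1"
proof -
  have "(0 :: 'a) \<in> cball 0 (\<kappa> powr (1 / \<theta>))" by simp
  then have "covering_number (cball (0 :: 'a) (\<kappa> powr (1 / \<theta>))) 1 \<ge> 1"
    by (intro covering_number_ge_1 bounded_cball) (blast | simp)+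
  then show ?thesis by (simp add: rescale_const_def)
qed

text \<open>Dividing a ball radius by \<open>\<kappa>\<close> also divides the associated covering
  radius, by \<open>\<kappa> powr (1 / \<theta>)\<close>. This is again a constant factor and is
  absorbed by doubling.\<close>

lemma covering_number_rescale:
  fixes E :: "'a::euclidean_space set"
  assumes "bounded E" "R > 0" "\<kappa> > 0"
  shows "real (covering_number E ((R / \<kappa>) powr (1 / \<theta>)))
    \<le> rescale_const TYPE('a) \<kappa> \<theta> * real (covering_number E (R powr (1 / \<theta>)))"
proof -
  have eq: "\<kappa> powr (1 / \<theta>) * (R / \<kappa>) powr (1 / \<theta>) = R powr (1 / \<theta>)"
    using assms by (simp add: powr_divide)
  have "covering_number E ((R / \<kappa>) powr (1 / \<theta>))
    \<le> covering_number (cball (0::'a) (\<kappa> powr (1 / \<theta>))) 1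
      * covering_number E (\<kappa> powr (1 / \<theta>) * (R / \<kappa>) powr (1 / \<theta>))"
    using assms by (intro covering_number_doubling) auto
  from of_nat_mono[OF this, where 'a=real] show ?thesis
    unfolding eq of_nat_mult rescale_const_def .
qed

lemma quotient_rescale:
  fixes R \<kappa> t \<theta> :: real
  assumes "R > 0" "\<kappa> > 0"
  shows "(R / \<kappa> / (R / \<kappa>) powr (1 / \<theta>)) powr t = \<kappa> powr ((1 / \<theta> - 1) * t) * (R / R powr (1 / \<theta>)) powr t"
proof -
  have "(R / \<kappa>) powr ((1 - 1 / \<theta>) * t) = R powr ((1 - 1 / \<theta>) * t) / \<kappa> powr ((1 - 1 / \<theta>) * t)"
    using assms by (simp add: powr_divide)
  moreover have "(1 / \<theta> - 1) * t = - ((1 - 1 / \<theta>) * t)" by (simp add: algebra_simps)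
  then have "\<kappa> powr ((1 / \<theta> - 1) * t) = 1 / \<kappa> powr ((1 - 1 / \<theta>) * t)"
    by (simp only: powr_minus_divide)
  moreover have "R / \<kappa> > 0" using assms by simp
  ultimately show ?thesis
    unfolding powr_scale_quotient[OF assms(1)] powr_scale_quotient[OF \<open>R / \<kappa> > 0\<close>] powr_powr by simp
qed

context sponge_system
begin

lemma F_nonempty: "F \<noteq> {}"
proof -
  obtain e where "e \<in> D" using D_nonempty by blast
  then have "(\<lambda>_. e) \<in> words" by (simp add: words_def)
  then show ?thesis unfolding F_eq by blast
qed

text \<open>All that the geometric part needs to know about the counts: growth with exponent
  \<open>t\<close> along the scale pairs of \<theta>, up to a bounded error.\<close>

definition spectrum_exponent :: "real \<Rightarrow> (nat \<Rightarrow> nat \<Rightarrow> nat) \<Rightarrow> real \<Rightarrow> bool" where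
  "spectrum_exponent \<theta> G t \<longleftrightarrow> (\<exists>K. \<forall>R. 0 < R \<and> R < 1 \<longrightarrow>
     \<bar>level_log G R (R powr (1 / \<theta>)) - t * ln (R / R powr (1 / \<theta>))\<bar> \<le> K)"

lemma spectrum_exponentE:
  assumes "spectrum_exponent \<theta> G t"
  obtains K where "K > 0"
    "\<And>R. 0 < R \<Longrightarrow> R < 1 \<Longrightarrow> exp (level_log G R (R powr (1 / \<theta>))) \<le> K * (R / R powr (1 / \<theta>)) powr t"
    "\<And>R. 0 < R \<Longrightarrow> R < 1 \<Longrightarrow> (R / R powr (1 / \<theta>)) powr t / K \<le> exp (level_log G R (R powr (1 / \<theta>)))"
proof -
  obtain K where K: "\<And>R. 0 < R \<Longrightarrow> R < 1 \<Longrightarrow>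
     \<bar>level_log G R (R powr (1 / \<theta>)) - t * ln (R / R powr (1 / \<theta>))\<bar> \<le> K"
    using assms unfolding spectrum_exponent_def by blast
  show thesis
  proof
    fix R :: real assume R: "0 < R" "R < 1"
    then have "R / R powr (1 / \<theta>) > 0" by simp
    from exp_approx[OF K[OF R] this]
    show "exp (level_log G R (R powr (1 / \<theta>))) \<le> exp K * (R / R powr (1 / \<theta>)) powr t"
      "(R / R powr (1 / \<theta>)) powr t / exp K \<le> exp (level_log G R (R powr (1 / \<theta>)))"
      by (simp_all add: exp_minus field_simps)
  qed simp
qed

definition inner_ratio :: real where
  "inner_ratio = real d * real (n d)"

lemma inner_ratio_gt_1: "inner_ratio > 1"
proof -
  have "1 * 2 \<le> d * n d" using d n_ge_2[of d] by (intro mult_le_mono) auto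
  then have "real 2 \<le> real (d * n d)" by (simp only: of_nat_le_iff)
  then show ?thesis by (simp add: inner_ratio_def)
qed

text \<open>The cube inside the ball has size \<open>R / inner_ratio\<close>, so counts are supplied
  at the pair of scales belonging to that size and must be carried back to the pair belonging to
  \<open>R\<close>.\<close>

lemma spectrum_ball_ge:
  assumes c: "c > 0"
  obtains c' where "c' > 0"
    "\<And>R \<omega>. 0 < R \<Longrightarrow> R < 1 \<Longrightarrow> \<omega> \<in> words \<Longrightarrow>
      c * (R / inner_ratio / (R / inner_ratio) powr (1 / \<theta>)) powr t \<le>
        real (card (code (lev ((R / inner_ratio) powr (1 / \<theta>))) ` cylinder (lev (R / inner_ratio)) \<omega>)) \<Longrightarrow>
      c' * (R / R powr (1 / \<theta>)) powr t \<le> real (covering_number (cball (X \<omega>) R \<inter> F) (R powr (1 / \<theta>)))"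
proof -
  let ?S = "rescale_const TYPE((real, 'd) vec) inner_ratio \<theta>"
  let ?k = "inner_ratio powr ((1 / \<theta> - 1) * t)"
  have S: "?S > 0" using rescale_const_ge_1[where 'a="(real, 'd) vec", of inner_ratio \<theta>] by linarith
  have k: "?k > 0" using inner_ratio_gt_1 by simp
  show thesis
  proof
    show "c * ?k / (4 ^ d * ?S) > 0" using c k S by simp
    fix R :: real and \<omega> assume R: "0 < R" "R < 1" and w: "\<omega> \<in> words"
      and le: "c * (R / inner_ratio / (R / inner_ratio) powr (1 / \<theta>)) powr t \<le>
        real (card (code (lev ((R / inner_ratio) powr (1 / \<theta>))) ` cylinder (lev (R / inner_ratio)) \<omega>))"
    let ?E = "cball (X \<omega>) R \<inter> F"
    let ?r = "(R / inner_ratio) powr (1 / \<theta>)"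
    have r: "?r > 0" using R inner_ratio_gt_1 by simp
    have "real (card (code (lev ?r) ` cylinder (lev (R / inner_ratio)) \<omega>)) \<le> real (4 ^ d * covering_number ?E ?r)"
      using of_nat_mono[OF covering_number_ball_ge[OF R(1) r w]] unfolding inner_ratio_def by blast
    also have "\<dots> = 4 ^ d * real (covering_number ?E ?r)" by simp
    also have "\<dots> \<le> 4 ^ d * (?S * real (covering_number ?E (R powr (1 / \<theta>))))"
      using R inner_ratio_gt_1 by (intro mult_left_mono covering_number_rescale) (auto simp: bounded_Int)
    finally have "c * (?k * (R / R powr (1 / \<theta>)) powr t) \<le> 4 ^ d * (?S * real (covering_number ?E (R powr (1 / \<theta>))))"
      using le inner_ratio_gt_1 R quotient_rescale[of R inner_ratio \<theta> t] by simp
    then have "c * ?k * (R / R powr (1 / \<theta>)) powr t \<le> real (covering_number ?E (R powr (1 / \<theta>))) * (4 ^ d * ?S)"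
      by (simp only: ac_simps)
    then have "c * ?k * (R / R powr (1 / \<theta>)) powr t / (4 ^ d * ?S) \<le> real (covering_number ?E (R powr (1 / \<theta>)))"
      using S by (subst pos_divide_le_eq) auto
    then show "c * ?k / (4 ^ d * ?S) * (R / R powr (1 / \<theta>)) powr t \<le> real (covering_number ?E (R powr (1 / \<theta>)))"
      by simp
  qed
qed

lemma spectrum_max_upper:
  assumes "spectrum_exponent \<theta> (ext_max D) t"
  obtains K where "K > 0"
    "\<And>R x. 0 < R \<Longrightarrow> R < 1 \<Longrightarrow>
      real (covering_number (cball x R \<inter> F) (R powr (1 / \<theta>))) \<le> K * (R / R powr (1 / \<theta>)) powr t"
proof -
  obtain K where K: "K > 0" "\<And>R. 0 < R \<Longrightarrow> R < 1 \<Longrightarrow>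
      exp (level_log (ext_max D) R (R powr (1 / \<theta>))) \<le> K * (R / R powr (1 / \<theta>)) powr t"
    using spectrum_exponentE[OF assms] by metis
  show thesis
  proof
    show "cover_const * 4 ^ d * K > 0" using K cover_const_ge_1 by simp
    fix R :: real and x :: "(real, 'd) vec" assume R: "0 < R" "R < 1"
    have "real (covering_number (cball x R \<inter> F) (R powr (1 / \<theta>)))
      \<le> cover_const * 4 ^ d * (K * (R / R powr (1 / \<theta>)) powr t)"
      using R order_trans[OF card_codes_le K(2)[OF R]] by (intro covering_number_ball_le) auto
    then show "real (covering_number (cball x R \<inter> F) (R powr (1 / \<theta>)))
      \<le> cover_const * 4 ^ d * K * (R / R powr (1 / \<theta>)) powr t" by (simp only: mult.assoc)
  qed
qed

lemma spectrum_max_lower: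
  assumes "spectrum_exponent \<theta> (ext_max D) t"
  obtains c where "c > 0"
    "\<And>R. 0 < R \<Longrightarrow> R < 1 \<Longrightarrow> \<exists>x\<in>F. c * (R / R powr (1 / \<theta>)) powr t
      \<le> real (covering_number (cball x R \<inter> F) (R powr (1 / \<theta>)))"
proof -
  obtain K where K: "K > 0" "\<And>R. 0 < R \<Longrightarrow> R < 1 \<Longrightarrow>
      (R / R powr (1 / \<theta>)) powr t / K \<le> exp (level_log (ext_max D) R (R powr (1 / \<theta>)))"
    using spectrum_exponentE[OF assms] by metis
  have "1 / K > 0" using K by simp
  from spectrum_ball_ge[OF this, where \<theta>=\<theta> and t=t] obtain c where c: "c > 0"
    "\<And>R \<omega>. 0 < R \<Longrightarrow> R < 1 \<Longrightarrow> \<omega> \<in> words \<Longrightarrow>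
      1 / K * (R / inner_ratio / (R / inner_ratio) powr (1 / \<theta>)) powr t \<le>
        real (card (code (lev ((R / inner_ratio) powr (1 / \<theta>))) ` cylinder (lev (R / inner_ratio)) \<omega>)) \<Longrightarrow>
      c * (R / R powr (1 / \<theta>)) powr t \<le> real (covering_number (cball (X \<omega>) R \<inter> F) (R powr (1 / \<theta>)))"
    by blast
  show thesis
  proof
    show "c > 0" by (rule c(1))
    fix R :: real assume R: "0 < R" "R < 1"
    have R': "0 < R / inner_ratio" "R / inner_ratio < 1" using R inner_ratio_gt_1 by auto
    obtain \<omega> where w: "\<omega> \<in> words" "real (card (code (lev ((R / inner_ratio) powr (1 / \<theta>))) ` cylinder (lev (R / inner_ratio)) \<omega>))
       = exp (level_log (ext_max D) (R / inner_ratio) ((R / inner_ratio) powr (1 / \<theta>)))"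
      using card_codes_max_attained by blast
    have "c * (R / R powr (1 / \<theta>)) powr t \<le> real (covering_number (cball (X \<omega>) R \<inter> F) (R powr (1 / \<theta>)))"
      using K(2)[OF R'] unfolding w(2)[symmetric] by (intro c(2)[OF R w(1)]) simp
    then show "\<exists>x\<in>F. c * (R / R powr (1 / \<theta>)) powr t \<le> real (covering_number (cball x R \<inter> F) (R powr (1 / \<theta>)))"
      using w(1) unfolding F_eq by blast
  qed
qed

lemma spectrum_min_lower:
  assumes "spectrum_exponent \<theta> (ext_min D) t"
  obtains c where "c > 0"
    "\<And>R x. 0 < R \<Longrightarrow> R < 1 \<Longrightarrow> x \<in> F \<Longrightarrow> c * (R / R powr (1 / \<theta>)) powr t
      \<le> real (covering_number (cball x R \<inter> F) (R powr (1 / \<theta>)))"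
proof -
  obtain K where K: "K > 0" "\<And>R. 0 < R \<Longrightarrow> R < 1 \<Longrightarrow>
      (R / R powr (1 / \<theta>)) powr t / K \<le> exp (level_log (ext_min D) R (R powr (1 / \<theta>)))"
    using spectrum_exponentE[OF assms] by metis
  have "1 / K > 0" using K by simp
  from spectrum_ball_ge[OF this, where \<theta>=\<theta> and t=t] obtain c where c: "c > 0"
    "\<And>R \<omega>. 0 < R \<Longrightarrow> R < 1 \<Longrightarrow> \<omega> \<in> words \<Longrightarrow>
      1 / K * (R / inner_ratio / (R / inner_ratio) powr (1 / \<theta>)) powr t \<le>
        real (card (code (lev ((R / inner_ratio) powr (1 / \<theta>))) ` cylinder (lev (R / inner_ratio)) \<omega>)) \<Longrightarrow>
      c * (R / R powr (1 / \<theta>)) powr t \<le> real (covering_number (cball (X \<omega>) R \<inter> F) (R powr (1 / \<theta>)))"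
    by blast
  show thesis
  proof
    show "c > 0" by (rule c(1))
    fix R :: real and x :: "(real, 'd) vec" assume R: "0 < R" "R < 1" and "x \<in> F"
    then obtain \<omega> where w: "\<omega> \<in> words" "x = X \<omega>" unfolding F_eq by blast
    have R': "0 < R / inner_ratio" "R / inner_ratio < 1" using R inner_ratio_gt_1 by auto
    show "c * (R / R powr (1 / \<theta>)) powr t \<le> real (covering_number (cball x R \<inter> F) (R powr (1 / \<theta>)))"
      unfolding w(2) using order_trans[OF K(2)[OF R'] card_codes_ge[OF w(1)]] by (intro c(2)[OF R w(1)]) simp
  qed
qed

lemma spectrum_min_upper:
  assumes "spectrum_exponent \<theta> (ext_min D) t"
  obtains K \<delta> where "K > 0" "\<delta> > 0"
    "\<And>R. 0 < R \<Longrightarrow> R < \<delta> \<Longrightarrow> \<exists>x\<in>F.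
      real (covering_number (cball x R \<inter> F) (R powr (1 / \<theta>))) \<le> K * (R / R powr (1 / \<theta>)) powr t"
proof -
  define \<kappa> where "\<kappa> = 2 * real (n d) ^ card D"
  have \<kappa>: "\<kappa> > 0" using n_pos[of d] d by (simp add: \<kappa>_def)
  let ?S = "rescale_const TYPE((real, 'd) vec) \<kappa> \<theta>"
  let ?k = "\<kappa> powr ((1 / \<theta> - 1) * t)"
  have S: "?S > 0" using rescale_const_ge_1[where 'a="(real, 'd) vec", of \<kappa> \<theta>] by linarith
  have k: "?k > 0" using \<kappa> by simp
  obtain K where K: "K > 0" "\<And>R. 0 < R \<Longrightarrow> R < 1 \<Longrightarrow>
      exp (level_log (ext_min D) R (R powr (1 / \<theta>))) \<le> K * (R / R powr (1 / \<theta>)) powr t"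
    using spectrum_exponentE[OF assms] by metis
  define m where "m = real (card D) ^ (d * card D)"
  have m: "m > 0" using D_nonempty by (simp add: m_def card_gt_0_iff)
  let ?K = "?S * cover_const * m * K / ?k"
  show thesis
  proof
    show "?K > 0" using K S k m cover_const_ge_1 by simp
    show "1 / \<kappa> > 0" using \<kappa> by simp
    fix R0 :: real assume R0: "0 < R0" "R0 < 1 / \<kappa>"
    \<comment> \<open>The cube is taken larger than the ball by the factor \<open>\<kappa>\<close>
      of the interior estimate, so that a ball of radius \<open>R0\<close> around an interior point
      meets one cube only. Keeping its size below 1 dictates the bound on \<open>R0\<close>.\<close>
    define R where "R = R0 * \<kappa>"
    have R: "0 < R" "R < 1" "R0 = R / \<kappa>" using R0 \<kappa> by (auto simp: R_def field_simps)
    let ?r = "R powr (1 / \<theta>)"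
    obtain \<omega> where w: "\<omega> \<in> words" "\<And>q. q \<in> {1..d} \<Longrightarrow> D \<subseteq> \<omega> ` {lev R q..<lev R q + card D}"
      "real (card (code (lev ?r) ` cylinder (lev R) \<omega>)) \<le> m * exp (level_log (ext_min D) R ?r)"
      using card_codes_min_interior[of R ?r] unfolding m_def by blast
    let ?E = "cball (X \<omega>) R0 \<inter> F"
    have "real (covering_number ?E (R0 powr (1 / \<theta>))) \<le> ?S * real (covering_number ?E ?r)"
      using covering_number_rescale[of ?E R \<kappa> \<theta>] R(1) \<kappa> unfolding R(3) by (simp add: bounded_Int)
    also have "\<dots> \<le> ?S * (cover_const * real (card (code (lev ?r) ` cylinder (lev R) \<omega>)))"
      using covering_number_interior_le[OF R(1) _ _ w(1,2), of ?r] R S unfolding \<kappa>_def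
      by (intro mult_left_mono) auto
    also have "\<dots> \<le> ?S * (cover_const * (m * (K * (R / ?r) powr t)))"
      using order_trans[OF w(3) mult_left_mono[OF K(2)[OF R(1,2)]]] m S cover_const_ge_1
      by (intro mult_left_mono) auto
    also have "\<dots> = ?K * (R0 / R0 powr (1 / \<theta>)) powr t"
      unfolding R(3) quotient_rescale[OF R(1) \<kappa>] using k by simp
    finally show "\<exists>x\<in>F. real (covering_number (cball x R0 \<inter> F) (R0 powr (1 / \<theta>)))
      \<le> ?K * (R0 / R0 powr (1 / \<theta>)) powr t"
      using w(1) unfolding F_eq by blast
  qed
qed

section \<open>Values of the spectra and dimensions\<close>

lemma assouad_spectrum_eq:
  assumes \<theta>: "0 < \<theta>" "\<theta> < 1" and t: "spectrum_exponent \<theta> (ext_max D) t"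
  shows "assouad_spectrum \<theta> F = t"
proof -
  obtain K where K: "K > 0" "\<And>R x. 0 < R \<Longrightarrow> R < 1 \<Longrightarrow>
      real (covering_number (cball x R \<inter> F) (R powr (1 / \<theta>))) \<le> K * (R / R powr (1 / \<theta>)) powr t"
    using spectrum_max_upper[OF t] by blast
  obtain c where c: "c > 0" "\<And>R. 0 < R \<Longrightarrow> R < 1 \<Longrightarrow> \<exists>x\<in>F. c * (R / R powr (1 / \<theta>)) powr t
      \<le> real (covering_number (cball x R \<inter> F) (R powr (1 / \<theta>)))"
    using spectrum_max_lower[OF t] by blast
  show ?thesis
    by (rule assouad_spectrum_set(3)[OF \<theta> F_nonempty K(1) c(1) zero_less_one]) (use K c in auto)
qed

lemma lower_spectrum_eq:
  assumes \<theta>: "0 < \<theta>" "\<theta> < 1" and t: "spectrum_exponent \<theta> (ext_min D) t"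
  shows "lower_spectrum \<theta> F = t"
proof -
  obtain K \<delta> where K: "K > 0" "\<delta> > 0" "\<And>R. 0 < R \<Longrightarrow> R < \<delta> \<Longrightarrow> \<exists>x\<in>F.
      real (covering_number (cball x R \<inter> F) (R powr (1 / \<theta>))) \<le> K * (R / R powr (1 / \<theta>)) powr t"
    using spectrum_min_upper[OF t] by blast
  obtain c where c: "c > 0" "\<And>R x. 0 < R \<Longrightarrow> R < 1 \<Longrightarrow> x \<in> F \<Longrightarrow> c * (R / R powr (1 / \<theta>)) powr t
      \<le> real (covering_number (cball x R \<inter> F) (R powr (1 / \<theta>)))"
    using spectrum_min_lower[OF t] by blast
  show ?thesis
    by (rule lower_spectrum_set(3)[OF \<theta> K(1) c(1) K(2)]) (use K c in auto)
qed

lemma assouad_dim_eq: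
  assumes \<theta>: "0 < \<theta>" "\<theta> < 1" and t: "spectrum_exponent \<theta> (ext_max D) (local_value (ext_max D))"
  shows "assouad_spectrum \<theta> F = assouad_dim F"
proof -
  let ?t = "local_value (ext_max D)"
  let ?K = "\<Sum>q=1..d. ln (real (ext_max D (q - 1) q))"
  obtain c where c: "c > 0" "\<And>R. 0 < R \<Longrightarrow> R < 1 \<Longrightarrow> \<exists>x\<in>F. c * (R / R powr (1 / \<theta>)) powr ?t
      \<le> real (covering_number (cball x R \<inter> F) (R powr (1 / \<theta>)))"
    using spectrum_max_lower[OF t] by blast
  have pos: "cover_const * 4 ^ d * exp ?K > 0" using cover_const_ge_1 by simp
  have upper: "real (covering_number (cball x R \<inter> F) r) \<le> cover_const * 4 ^ d * exp ?K * (R / r) powr ?t"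
    if r: "0 < r" "r < R" for r R x
  proof -
    have "exp (level_log (ext_max D) R r) \<le> exp (?t * ln (R / r) + ?K)"
      using level_log_max_le[of r R] r by simp
    also have "\<dots> = exp ?K * (R / r) powr ?t" using r by (simp add: exp_add powr_def)
    finally have "real (covering_number (cball x R \<inter> F) r) \<le> cover_const * 4 ^ d * (exp ?K * (R / r) powr ?t)"
      using r order_trans[OF card_codes_le] by (intro covering_number_ball_le) auto
    then show ?thesis by (simp only: mult.assoc)
  qed
  show ?thesis
    using assouad_dim_eqI[where t="?t", OF \<theta> F_nonempty pos c(1) zero_less_one upper c(2)] by simp
qed

lemma lower_dim_eq:
  assumes \<theta>: "0 < \<theta>" "\<theta> < 1" and t: "spectrum_exponent \<theta> (ext_min D) (local_value (ext_min D))"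
  shows "lower_spectrum \<theta> F = lower_dim F"
proof -
  let ?t = "local_value (ext_min D)"
  let ?K = "\<Sum>q=1..d. ln (real (ext_min D (q - 1) q))"
  let ?\<kappa> = inner_ratio
  obtain K \<delta> where K: "K > 0" "\<delta> > 0" "\<And>R. 0 < R \<Longrightarrow> R < \<delta> \<Longrightarrow> \<exists>x\<in>F.
      real (covering_number (cball x R \<inter> F) (R powr (1 / \<theta>))) \<le> K * (R / R powr (1 / \<theta>)) powr ?t"
    using spectrum_min_upper[OF t] by blast
  have ln_pos: "ln (real (ext_min D s u)) \<ge> 0" for s u using ext_min_ge_1[of s u] by simp
  have K_pos: "?K \<ge> 0" using ln_pos by (intro sum_nonneg) auto
  have t_pos: "?t \<ge> 0" unfolding local_value_def using ln_pos ln_n_pos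
    by (intro sum_nonneg divide_nonneg_pos) auto
  define c where "c = exp (- ?K) / (4 ^ d * ?\<kappa> powr ?t)"
  have \<kappa>t: "?\<kappa> powr ?t > 0" using inner_ratio_gt_1 by simp
  have c: "c > 0" using \<kappa>t by (simp add: c_def)
  have lower: "c * (R / r) powr ?t \<le> real (covering_number (cball x R \<inter> F) r)"
    if r: "0 < r" "r < R" "R < 1" and x: "x \<in> F" for r R x
  proof -
    obtain \<omega> where w: "\<omega> \<in> words" "x = X \<omega>" using x unfolding F_eq by blast
    have R: "0 < R" using r by simp
    have split: "(R / r) powr ?t = ?\<kappa> powr ?t * (R / ?\<kappa> / r) powr ?t"
      using inner_ratio_gt_1 r by (simp flip: powr_mult)
    have ceq: "c * (R / r) powr ?t = exp (- ?K) * (R / ?\<kappa> / r) powr ?t / 4 ^ d"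
      unfolding split c_def using \<kappa>t by simp
    show ?thesis
    \<comment> \<open>When \<open>r\<close> exceeds the size of the inner cube there is nothing to
      count; then the power is at most 1 and a covering number of at least 1 is enough.\<close>
    proof (cases "r \<le> R / ?\<kappa>")
      case True
      have R': "R / ?\<kappa> \<le> 1" using inner_ratio_gt_1 r by simp
      have "exp (- ?K) * (R / ?\<kappa> / r) powr ?t = exp (?t * ln (R / ?\<kappa> / r) - ?K)"
        using R r(1) inner_ratio_gt_1 by (simp add: powr_def exp_diff exp_minus field_simps)
      also have "\<dots> \<le> exp (level_log (ext_min D) (R / ?\<kappa>) r)"
        using level_log_min_ge[OF r(1) True R'] by simp
      also have "\<dots> \<le> real (card (code (lev r) ` cylinder (lev (R / ?\<kappa>)) \<omega>))"
        by (rule card_codes_ge[OF w(1)])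
      also have "\<dots> \<le> real (4 ^ d * covering_number (cball x R \<inter> F) r)"
        using covering_number_ball_ge[OF R r(1) w(1)] unfolding w(2) inner_ratio_def of_nat_le_iff .
      finally show ?thesis unfolding ceq by (simp add: field_simps)
    next
      case False
      have "R / ?\<kappa> / r \<le> r / r" using False r(1) by (intro divide_right_mono) auto
      then have "R / ?\<kappa> / r \<le> 1" using r(1) by simp
      then have "(R / ?\<kappa> / r) powr ?t \<le> 1"
        using R r(1) inner_ratio_gt_1 t_pos by (intro powr_le1) auto
      then have "exp (- ?K) * (R / ?\<kappa> / r) powr ?t \<le> 1 * 1"
        using K_pos by (intro mult_mono) auto
      then have "c * (R / r) powr ?t \<le> 1 / 4 ^ d" unfolding ceq by (intro divide_right_mono) auto
      also have "\<dots> \<le> 1" by simp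
      also have "1 \<le> real (covering_number (cball x R \<inter> F) r)"
        using covering_number_ball_ge_1[OF x R r(1)] by simp
      finally show ?thesis .
    qed
  qed
  show ?thesis using lower_dim_eqI[where t="?t", OF \<theta> K(1) c K(2) lower K(3)] by simp
qed

text \<open>The box dimension is the case \<open>R = 1\<close>: all depths are 0, one cylinder
  contains every word, and the term with \<open>fibre_value\<close> is multiplied by
  \<open>ln 1\<close>. A bounded error in \<open>ln N\<close> disappears after division by
  \<open>ln (1 / r)\<close>.\<close>

lemma box_dim_eq: "box_dim F = box_value"
proof -
  obtain K where K: "\<And>r. 0 < r \<Longrightarrow> r \<le> 1 \<Longrightarrow> \<bar>level_log (ext_max D) 1 r - box_value * ln (1 / r)\<bar> \<le> K"
  proof -
    obtain K where K: "\<forall>R r. 0 < R \<and> R \<le> 1 \<and> 0 < r \<and> r \<le> 1 \<and> lev R 1 \<le> lev r d \<longrightarrow>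
      \<bar>level_log (ext_max D) R r - (box_value * ln (1 / r) - fibre_value (ext_max D) * ln (1 / R))\<bar> \<le> K"
      using level_log_separated_approx[of "ext_max D"] ext_max_0[OF D_nonempty] by blast
    have "lev 1 1 = 0" by (simp add: lev_def)
    then have "\<bar>level_log (ext_max D) 1 r - box_value * ln (1 / r)\<bar> \<le> K" if "0 < r" "r \<le> 1" for r
      using K[rule_format, of 1 r] that by simp
    then show thesis by (rule that)
  qed
  have all: "cylinder (lev 1) \<omega>' = words" if "\<omega>' \<in> words" for \<omega>' by (auto simp: cylinder_def code_def lev_def)
  have count: "real (card (code (lev r) ` words)) = exp (level_log (ext_max D) 1 r)" for r
    using card_codes_max_attained[of r 1] all by auto
  let ?C = "K + ln cover_const + ln (4 ^ d)"
  let ?N = "\<lambda>r. real (covering_number F r)"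
  have bound: "\<bar>ln (?N r) - box_value * ln (1 / r)\<bar> \<le> ?C" if r: "0 < r" "r < 1" for r
  proof -
    have N: "?N r \<ge> 1"
      using covering_number_ge_1[OF _ F_nonempty r(1)] bounded_X[of words] unfolding F_eq by simp
    have "?N r \<le> cover_const * exp (level_log (ext_max D) 1 r)"
      using covering_number_le_codes[OF order_refl r(1)] unfolding F_eq count .
    then have "ln (?N r) \<le> ln (cover_const * exp (level_log (ext_max D) 1 r))"
      using N by (intro ln_mono) auto
    also have "\<dots> = ln cover_const + level_log (ext_max D) 1 r"
      using cover_const_ge_1 by (simp add: ln_mult)
    finally have up: "ln (?N r) \<le> ln cover_const + level_log (ext_max D) 1 r" .
    have "real (card (code (lev r) ` words)) \<le> real (4 ^ d * covering_number F r)"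
      using codes_le_covering_number[OF order_refl r(1)] unfolding F_eq of_nat_le_iff .
    then have "exp (level_log (ext_max D) 1 r) \<le> 4 ^ d * ?N r" unfolding count by simp
    then have "ln (exp (level_log (ext_max D) 1 r)) \<le> ln (4 ^ d * ?N r)"
      by (intro ln_mono) auto
    also have "\<dots> = ln (4 ^ d) + ln (?N r)" using N by (simp add: ln_mult)
    finally have lo: "level_log (ext_max D) 1 r \<le> ln (4 ^ d) + ln (?N r)" by simp
    have "ln cover_const \<ge> 0" "ln (4 ^ d :: real) \<ge> 0" using cover_const_ge_1 by simp_all
    then show ?thesis using K[of r] r up lo by linarith
  qed
  have top: "filterlim (\<lambda>r::real. ln (1 / r)) at_top (at_right 0)"
  proof -
    have "filterlim (\<lambda>r::real. - ln r) at_top (at_right 0)"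
      using ln_at_0 by (simp add: filterlim_uminus_at_top)
    then show ?thesis
      by (rule filterlim_cong[THEN iffD1, rotated 3]) (auto simp: ln_div eventually_at_filter)
  qed
  have "((\<lambda>r. ln (?N r) / ln (1 / r)) \<longlongrightarrow> box_value) (at_right 0)"
  proof (rule LIM_zero_cancel, rule Lim_null_comparison)
    have "\<forall>\<^sub>F r::real in at_right 0. r \<in> {0<..<1}" by (rule eventually_at_right_real) simp
    then show "\<forall>\<^sub>F r in at_right 0. norm (ln (?N r) / ln (1 / r) - box_value) \<le> ?C / ln (1 / r)"
    proof eventually_elim
      case (elim r)
      then have "ln (1 / r) > 0" by simp
      then have "ln (?N r) / ln (1 / r) - box_value = (ln (?N r) - box_value * ln (1 / r)) / ln (1 / r)"
        by (simp add: diff_divide_distrib)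
      then show ?case
        using bound[of r] elim \<open>ln (1 / r) > 0\<close> by (simp add: abs_divide divide_right_mono)
    qed
    show "((\<lambda>r. ?C / ln (1 / r)) \<longlongrightarrow> 0) (at_right 0)"
      by (rule tendsto_divide_0[OF tendsto_const filterlim_at_top_imp_at_infinity[OF top]])
  qed
  then show ?thesis unfolding box_dim_def by (rule tendsto_Lim[rotated]) simp
qed

text \<open>The condition on \<theta> says that the unrounded depth of the first coordinate at
  \<open>R\<close> does not exceed that of the last at \<open>r\<close>, and rounding down is
  monotone. The exponent is then
  \<open>(box_value / \<theta> - fibre_value G) / (1 / \<theta> - 1)\<close>.\<close>

lemma spectrum_exponent_small:
  assumes \<theta>: "0 < \<theta>" "\<theta> < 1" "\<theta> \<le> ln (real (n 1)) / ln (real (n d))"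
    and G: "\<And>t. G 0 t = card (digit_proj t D)"
  shows "spectrum_exponent \<theta> G ((box_value - \<theta> * fibre_value G) / (1 - \<theta>))"
proof -
  let ?t = "(box_value - \<theta> * fibre_value G) / (1 - \<theta>)"
  obtain K where K: "\<forall>R r. 0 < R \<and> R \<le> 1 \<and> 0 < r \<and> r \<le> 1 \<and> lev R 1 \<le> lev r d \<longrightarrow>
      \<bar>level_log G R r - (box_value * ln (1 / r) - fibre_value G * ln (1 / R))\<bar> \<le> K"
    using level_log_separated_approx[where G=G, OF G] by blast
  have "\<bar>level_log G R (R powr (1 / \<theta>)) - ?t * ln (R / R powr (1 / \<theta>))\<bar> \<le> K" if R: "0 < R" "R < 1" for R
  proof -
    let ?r = "R powr (1 / \<theta>)"
    have r: "0 < ?r" "?r < R" using scale_quotient_ge_1[OF \<theta>(1,2) R] by auto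
    have L: "ln (1 / R) > 0" using R by simp
    have "1 / ln (real (n 1)) \<le> 1 / (\<theta> * ln (real (n d)))"
      using \<theta> ln_n_pos[of 1] ln_n_pos[of d] d by (intro divide_left_mono) (auto simp: field_simps)
    from mult_left_mono[OF this less_imp_le[OF L]]
    have "ln (1 / R) / ln (real (n 1)) \<le> ln (1 / ?r) / ln (real (n d))"
      unfolding ln_scale_quotient(2)[OF R(1) \<theta>(1)] by simp
    then have "lev R 1 \<le> lev ?r d" unfolding lev_def by (intro nat_mono floor_mono)
    then have "\<bar>level_log G R ?r - (box_value * ln (1 / ?r) - fibre_value G * ln (1 / R))\<bar> \<le> K"
      using K[rule_format, of R ?r] R r by linarith
    moreover have "box_value * ln (1 / ?r) - fibre_value G * ln (1 / R) = ?t * ln (R / ?r)"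
      unfolding ln_scale_quotient[OF R(1) \<theta>(1)] using \<theta>(1,2) by (simp add: field_simps)
    ultimately show ?thesis by simp
  qed
  then show ?thesis unfolding spectrum_exponent_def by blast
qed

text \<open>Each condition on \<theta> says that the unrounded depth of coordinate
  \<open>p + 1\<close> at \<open>r\<close> is at most that of coordinate \<open>p\<close> at
  \<open>R\<close>. Quotients of neighbouring bases suffice for interlacing.\<close>

lemma spectrum_exponent_large:
  assumes \<theta>: "0 < \<theta>" "\<theta> < 1"
    "\<And>p. 1 \<le> p \<Longrightarrow> Suc p \<le> d \<Longrightarrow> ln (real (n p)) / ln (real (n (Suc p))) \<le> \<theta>"
    and G: "\<And>s. G s s = 1" "\<And>s t. G s t \<ge> 1"
  shows "spectrum_exponent \<theta> G (local_value G)"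
proof -
  have "\<bar>level_log G R (R powr (1 / \<theta>)) - local_value G * ln (R / R powr (1 / \<theta>))\<bar>
      \<le> (\<Sum>q=1..d. ln (real (G (q - 1) q)))" if R: "0 < R" "R < 1" for R
  proof (rule level_log_interlaced_approx[where G=G, OF G])
    let ?r = "R powr (1 / \<theta>)"
    show "0 < ?r" "?r \<le> R" "R \<le> 1" using scale_quotient_ge_1[OF \<theta>(1,2) R] R by auto
    have L: "ln (1 / R) > 0" using R by simp
    fix p assume p: "1 \<le> p" "Suc p \<le> d"
    have "1 / (\<theta> * ln (real (n (Suc p)))) \<le> 1 / ln (real (n p))"
      using \<theta>(1) \<theta>(3)[OF p] ln_n_pos[of p] ln_n_pos[of "Suc p"] p
      by (intro divide_left_mono) (auto simp: field_simps)
    from mult_left_mono[OF this less_imp_le[OF L]]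
    have "ln (1 / ?r) / ln (real (n (Suc p))) \<le> ln (1 / R) / ln (real (n p))"
      unfolding ln_scale_quotient(2)[OF R(1) \<theta>(1)] by simp
    then show "lev ?r (Suc p) \<le> lev R p" unfolding lev_def by (intro nat_mono floor_mono)
  qed
  then show ?thesis unfolding spectrum_exponent_def by blast
qed

text \<open>A reindexing with \<open>k = q - 1\<close>. The end terms are split off because the
  values |D| at index 0 and 1 at index \<open>d\<close> are not among the numbers
  \<open>N k\<close>.\<close>

lemma fibre_value_eq:
  assumes d2: "d \<ge> 2" and G: "G 0 d = card D" "G d d = 1" "\<And>s t. G s t \<ge> 1"
    and N: "\<forall>k\<in>{1..d - 1}. N k = G k d"
  shows "ln (real (card D) / real (N 1)) / ln (real (n 1))
     + (\<Sum>k=1..d-2. ln (real (N k) / real (N (k+1))) / ln (real (n (k+1))))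
     + ln (real (N (d-1))) / ln (real (n d)) = fibre_value G"
proof -
  obtain m where m: "d = Suc (Suc m)" using d2 by (metis Suc_le_D numeral_2_eq_2 Suc_le_mono)
  have pos: "real (G s t) > 0" for s t using G(3)[of s t] by linarith
  let ?f = "\<lambda>q. (ln (real (G (q - 1) d)) - ln (real (G q d))) / ln (real (n q))"
  have "fibre_value G = (\<Sum>q=1..Suc m. ?f q) + ?f d"
    unfolding fibre_value_def by (simp add: m)
  also have "(\<Sum>q=1..Suc m. ?f q) = ?f 1 + (\<Sum>q=Suc 1..Suc m. ?f q)"
    by (rule sum.atLeast_Suc_atMost) simp
  also have "(\<Sum>q=Suc 1..Suc m. ?f q) = (\<Sum>k=1..m. ?f (Suc k))" by (rule sum.shift_bounds_cl_Suc_ivl)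
  also have "\<dots> = (\<Sum>k=1..d-2. ln (real (N k) / real (N (k+1))) / ln (real (n (k+1))))"
    using N pos by (intro sum.cong) (auto simp: m ln_div)
  also have "?f 1 = ln (real (card D) / real (N 1)) / ln (real (n 1))"
  proof -
    have "real (card D) > 0" using pos[of 0 d] G(1) by simp
    then show ?thesis using bspec[OF N, of 1] G(1) pos[of 1 d] d2 by (subst ln_div) auto
  qed
  also have "?f d = ln (real (N (d-1))) / ln (real (n d))"
    using bspec[OF N, of "d - 1"] G(2) d2 by simp
  finally show ?thesis by simp
qed

end

theorem theorem3p6:
  fixes d :: nat
    and n :: "nat \<Rightarrow> nat"
    and D :: "(nat \<Rightarrow> nat) set"
    and F :: "(real ^ ('d::{finite,linorder})) set"
  assumes dim: "d = CARD('d)" "d \<ge> 2"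
    and n: "2 \<le> n 1" "strict_mono_on {1..d} n"
    and D: "D \<subseteq> digit_tuples d n" "card D \<ge> 2"
    and F: "F = sponge n D"
    and non_uniform: "\<not> uniform_fibres d n D"
  shows "(\<forall>\<theta>\<in>{0<..ln (real (n 1)) / ln (real (n d))}.
      assouad_spectrum \<theta> F =
        (box_dim F - \<theta> * (ln (real (card D) / real (N_max d n D 1)) / ln (real (n 1))
           + (\<Sum>k=1..d-2. ln (real (N_max d n D k) / real (N_max d n D (k+1))) / ln (real (n (k+1))))
           + ln (real (N_max d n D (d-1))) / ln (real (n d)))) / (1 - \<theta>) \<and>
      lower_spectrum \<theta> F =
        (box_dim F - \<theta> * (ln (real (card D) / real (N_min d n D 1)) / ln (real (n 1))
           + (\<Sum>k=1..d-2. ln (real (N_min d n D k) / real (N_min d n D (k+1))) / ln (real (n (k+1))))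
           + ln (real (N_min d n D (d-1))) / ln (real (n d)))) / (1 - \<theta>))
    \<and> (\<forall>\<theta>\<in>{Max {ln (real (n p)) / ln (real (n q)) | p q. 1 \<le> p \<and> p < q \<and> q \<le> d}..<1}.
      assouad_spectrum \<theta> F = assouad_dim F \<and> lower_spectrum \<theta> F = lower_dim F)"
proof -
  note d2 = dim(2)
  have "D \<noteq> {}" using D(2) by auto
  then interpret sponge_system d n D "TYPE('d)"
    using dim n D(1) by unfold_locales auto
  note max_0 = ext_max_0[OF D_nonempty] and min_0 = ext_min_0[OF D_nonempty]
  have full: "ext_max D 0 d = card D" "ext_min D 0 d = card D"
    by (simp_all add: max_0 min_0 digit_proj_full)
  have N: "\<forall>k\<in>{1..d - 1}. N_max d n D k = ext_max D k d" "\<forall>k\<in>{1..d - 1}. N_min d n D k = ext_min D k d"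
    by (simp_all add: N_max_eq N_min_eq)
  note max_value = fibre_value_eq[where G="ext_max D" and N="N_max d n D",
      OF d2 full(1) ext_max_diag ext_max_ge_1 N(1)]
  note min_value = fibre_value_eq[where G="ext_min D" and N="N_min d n D",
      OF d2 full(2) ext_min_diag ext_min_ge_1 N(2)]
  show ?thesis
    unfolding F max_value min_value box_dim_eq
  proof (intro conjI ballI)
    fix \<theta> assume "\<theta> \<in> {0<..ln (real (n 1)) / ln (real (n d))}"
    then have \<theta>: "0 < \<theta>" "\<theta> \<le> ln (real (n 1)) / ln (real (n d))" by auto
    \<comment> \<open>Two distinct bases put the threshold below 1, so \<open>1 - \<theta>\<close>
      is positive.\<close>
    have "n 1 < n d" using strict_mono_onD[OF n(2), of 1 d] d2 by simp
    then have "ln (real (n 1)) < ln (real (n d))" using n_pos[of 1] d by simp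
    then have "ln (real (n 1)) / ln (real (n d)) < 1" using ln_n_pos[of d] d by simp
    then have \<theta>1: "\<theta> < 1" using \<theta>(2) by linarith
    show "assouad_spectrum \<theta> (sponge n D :: (real, 'd) vec set) = (box_value - \<theta> * fibre_value (ext_max D)) / (1 - \<theta>)"
      by (rule assouad_spectrum_eq[OF \<theta>(1) \<theta>1 spectrum_exponent_small[where G="ext_max D", OF \<theta>(1) \<theta>1 \<theta>(2) max_0]])
    show "lower_spectrum \<theta> (sponge n D :: (real, 'd) vec set) = (box_value - \<theta> * fibre_value (ext_min D)) / (1 - \<theta>)"
      by (rule lower_spectrum_eq[OF \<theta>(1) \<theta>1 spectrum_exponent_small[where G="ext_min D", OF \<theta>(1) \<theta>1 \<theta>(2) min_0]])
  next
    let ?S = "{ln (real (n p)) / ln (real (n q)) | p q. 1 \<le> p \<and> p < q \<and> q \<le> d}"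
    fix \<theta> assume "\<theta> \<in> {Max ?S..<1}"
    then have \<theta>: "Max ?S \<le> \<theta>" "\<theta> < 1" by auto
    have "?S \<subseteq> (\<lambda>(p, q). ln (real (n p)) / ln (real (n q))) ` ({1..d} \<times> {1..d})" by force
    then have "finite ?S" by (rule finite_subset) auto
    then have le: "ln (real (n p)) / ln (real (n (Suc p))) \<le> \<theta>" if "1 \<le> p" "Suc p \<le> d" for p
      using that \<theta>(1) by (intro order_trans[OF Max_ge \<theta>(1)]) auto
    \<comment> \<open>Since \<open>d \<ge> 2\<close>, the set of quotients contains this positive
      one, which lies below its maximum and hence below \<theta>.\<close>
    have "0 < ln (real (n 1)) / ln (real (n (Suc 1)))" using ln_n_pos[of 1] ln_n_pos[of "Suc 1"] d2 by simp
    then have \<theta>0: "0 < \<theta>" using le[of 1] d2 by simp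
    show "assouad_spectrum \<theta> (sponge n D :: (real, 'd) vec set) = assouad_dim (sponge n D :: (real, 'd) vec set)"
      by (rule assouad_dim_eq[OF \<theta>0 \<theta>(2) spectrum_exponent_large[where G="ext_max D", OF \<theta>0 \<theta>(2) le ext_max_diag ext_max_ge_1]])
    show "lower_spectrum \<theta> (sponge n D :: (real, 'd) vec set) = lower_dim (sponge n D :: (real, 'd) vec set)"
      by (rule lower_dim_eq[OF \<theta>0 \<theta>(2) spectrum_exponent_large[where G="ext_min D", OF \<theta>0 \<theta>(2) le ext_min_diag ext_min_ge_1]])
  qed
qed

end
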